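(* Let $n\ge 1$. For degree two homogeneous polynomials the symmetric geometric rank coincides with the symmetric rank; i.e., for every $r\geq 1$, $$\mathcal{S}_{2,r}=\sigma_r(X_2),$$ where $X_2=\nu_2(\mathbb{P}^n)$ is the second Veronese variety.
   Context: Points of $\mathbb{P}(\mathrm{Sym}^d\mathbb{C}^{n+1})$ are identified with classes $[F]$ of nonzero homogeneous polynomials $F\in\mathbb{C}[x_0,\dots,x_n]$ of degree $d$. The symmetric geometric rank of $F$ is $\mathrm{sgr}(F)=\mathrm{codim}_{\mathbb{P}^n}\{[x]\in\mathbb{P}^n:\frac{\partial F}{\partial x_i}(x)=0,\ i=0,\dots,n\}$ (the empty set having codimension $n+1$), and $\mathcal{S}_{d,r}=\{[F]\in\mathbb{P}(\mathrm{Sym}^d\mathbb{C}^{n+1}) : \mathrm{sgr}(F)\leq r\}$. The symmetric rank of $T\in\mathrm{Sym}^d\mathbb{C}^{n+1}$ is the minimum number of elementary symmetric tensors $v^{\otimes d}$ needed to write $T$ as their sum. The $d$th Veronese embedding is $\nu_d:\mathbb{P}^n\to\mathbb{P}(\mathrm{Sym}^d\mathbb{C}^{n+1})$, $[v]\mapsto[v^{\otimes d}]$, and $X_d=\nu_d(\mathbb{P}^n)$. For a projective variety $X\subset\mathbb{P}^N$, $\sigma_r(X)=\overline{\bigcup_{p_1,\dots,p_r\in X}\mathrm{span}\{p_1,\dots,p_r\}}$ is its $r$th secant variety. *)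

theory Defs
  imports "HOL-Analysis.Analysis" "HOL-Library.Poly_Mapping" "HOL-Library.Function_Algebras"
begin

section \<open>Complex polynomials in several variables\<close>

text \<open>Polynomials with complex coefficients in variables \<open>x\<^sub>i\<close>, \<open>i :: 'i\<close>, as finitely supported
  maps from exponent vectors to coefficients; the ring structure is that of
  \<^theory>\<open>HOL-Library.Poly_Mapping\<close>.\<close>

type_synonym 'i cpoly = "('i \<Rightarrow>\<^sub>0 nat) \<Rightarrow>\<^sub>0 complex"

definition mon_degree :: "('i \<Rightarrow>\<^sub>0 nat) \<Rightarrow> nat" where
  "mon_degree m = (\<Sum>i\<in>Poly_Mapping.keys m. Poly_Mapping.lookup m i)"

definition homogeneous :: "nat \<Rightarrow> 'i cpoly \<Rightarrow> bool" where
  "homogeneous d F \<longleftrightarrow> (\<forall>m\<in>Poly_Mapping.keys F. mon_degree m = d)"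

definition poly_eval :: "'i cpoly \<Rightarrow> ('i \<Rightarrow> complex) \<Rightarrow> complex" where
  "poly_eval F x = (\<Sum>m\<in>Poly_Mapping.keys F.
     Poly_Mapping.lookup F m * (\<Prod>i\<in>Poly_Mapping.keys m. x i ^ Poly_Mapping.lookup m i))"

text \<open>Exponent vectors are subtracted with truncation, but a monomial free of \<open>x\<^sub>i\<close> contributes
  the coefficient \<open>0\<close>.\<close>

definition partial_deriv :: "'i \<Rightarrow> 'i cpoly \<Rightarrow> 'i cpoly" where
  "partial_deriv i F = (\<Sum>m\<in>Poly_Mapping.keys F.
     Poly_Mapping.single (m - Poly_Mapping.single i 1)
       (of_nat (Poly_Mapping.lookup m i) * Poly_Mapping.lookup F m))"


section \<open>Projective spaces and the Zariski topology\<close>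

definition cscale :: "complex \<Rightarrow> ('i \<Rightarrow> complex) \<Rightarrow> 'i \<Rightarrow> complex" where
  "cscale c x = (\<lambda>i. c * x i)"

interpretation cfun: vector_space cscale
  by unfold_locales (auto simp: cscale_def fun_eq_iff algebra_simps)

definition proj_point :: "('i \<Rightarrow> complex) \<Rightarrow> ('i \<Rightarrow> complex) set" where
  "proj_point x = {cscale c x | c. c \<noteq> 0}"

text \<open>The projective space of a linear subspace \<open>W\<close> of the space of coordinate vectors.
  With \<open>'n\<close> a type of \<open>n + 1\<close> elements, \<open>proj_space (UNIV :: ('n \<Rightarrow> complex) set)\<close> is
  \<open>n\<close>-dimensional projective space.\<close>

definition proj_space :: "('i \<Rightarrow> complex) set \<Rightarrow> ('i \<Rightarrow> complex) set set" where
  "proj_space W = proj_point ` (W - {0})"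

definition proj_zeros :: "('i \<Rightarrow> complex) set \<Rightarrow> 'i cpoly set \<Rightarrow> ('i \<Rightarrow> complex) set set" where
  "proj_zeros W A = {p \<in> proj_space W. \<forall>G\<in>A. \<forall>x\<in>p. poly_eval G x = 0}"

definition zariski_closed :: "('i \<Rightarrow> complex) set \<Rightarrow> ('i \<Rightarrow> complex) set set \<Rightarrow> bool" where
  "zariski_closed W S \<longleftrightarrow> (\<exists>A. (\<forall>G\<in>A. \<exists>e. homogeneous e G) \<and> S = proj_zeros W A)"

definition zariski_closure ::
  "('i \<Rightarrow> complex) set \<Rightarrow> ('i \<Rightarrow> complex) set set \<Rightarrow> ('i \<Rightarrow> complex) set set" where
  "zariski_closure W S = zariski_closed W hull S"

definition irreducible_closed :: "('i \<Rightarrow> complex) set \<Rightarrow> ('i \<Rightarrow> complex) set set \<Rightarrow> bool" where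
  "irreducible_closed W Z \<longleftrightarrow> zariski_closed W Z \<and> Z \<noteq> {} \<and>
     (\<forall>Z1 Z2. zariski_closed W Z1 \<longrightarrow> zariski_closed W Z2 \<longrightarrow> Z = Z1 \<union> Z2 \<longrightarrow> Z = Z1 \<or> Z = Z2)"

text \<open>Krull dimension of a closed set \<open>S\<close>: the supremum of the lengths \<open>k - 1\<close> of chains of \<open>k\<close>
  irreducible closed subsets of \<open>S\<close>. The empty chain, \<open>k = 0\<close>, is admitted, which gives the empty
  set dimension \<open>-1\<close>. The supremum is over a nonempty set of integers, which is bounded when \<open>W\<close>
  is finite-dimensional.\<close>

definition proj_dim :: "('i \<Rightarrow> complex) set \<Rightarrow> ('i \<Rightarrow> complex) set set \<Rightarrow> int" where
  "proj_dim W S = Sup {int k - 1 | k.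
     \<exists>Z :: nat \<Rightarrow> ('i \<Rightarrow> complex) set set.
       (\<forall>j<k. irreducible_closed W (Z j) \<and> Z j \<subseteq> S) \<and> (\<forall>j. Suc j < k \<longrightarrow> Z j \<subset> Z (Suc j))}"

text \<open>Codimension in \<open>n\<close>-dimensional projective space, where \<open>n + 1 = CARD('n)\<close>;
  the empty set has codimension \<open>n + 1\<close>.\<close>

definition proj_codim :: "('n::finite \<Rightarrow> complex) set set \<Rightarrow> int" where
  "proj_codim S = (int CARD('n) - 1) - proj_dim UNIV S"

definition proj_span ::
  "('i \<Rightarrow> complex) set \<Rightarrow> ('i \<Rightarrow> complex) set set \<Rightarrow> ('i \<Rightarrow> complex) set set" where
  "proj_span W P = proj_space (W \<inter> cfun.span (\<Union>P))"

definition secant_variety ::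
  "('i \<Rightarrow> complex) set \<Rightarrow> nat \<Rightarrow> ('i \<Rightarrow> complex) set set \<Rightarrow> ('i \<Rightarrow> complex) set set" where
  "secant_variety W r X =
     zariski_closure W (\<Union>p\<in>{p. \<forall>j<r. p j \<in> X}. proj_span W (p ` {..<(r::nat)}))"


section \<open>Symmetric tensors as homogeneous polynomials\<close>

text \<open>\<open>Sym\<^sup>d\<close> of the space of vectors \<open>'n \<Rightarrow> complex\<close>, realised as the space of coefficient vectors of
  degree \<open>d\<close> forms. Its coordinates are indexed by all exponent vectors; those of degree other
  than \<open>d\<close> vanish on it, so they do not affect its Zariski topology.\<close>

definition sym_space :: "nat \<Rightarrow> (('n::finite \<Rightarrow>\<^sub>0 nat) \<Rightarrow> complex) set" where
  "sym_space d = Poly_Mapping.lookup ` {F. homogeneous d F}"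

definition form_point :: "'n::finite cpoly \<Rightarrow> (('n \<Rightarrow>\<^sub>0 nat) \<Rightarrow> complex) set" where
  "form_point F = proj_point (Poly_Mapping.lookup F)"

text \<open>The form of the elementary symmetric tensor \<open>v\<^sup>\<otimes>\<^sup>d\<close>, namely \<open>(\<Sum>\<^sub>i v\<^sub>i x\<^sub>i)\<^sup>d\<close>.\<close>

definition elementary_sym :: "nat \<Rightarrow> ('n::finite \<Rightarrow> complex) \<Rightarrow> 'n cpoly" where
  "elementary_sym d v = (\<Sum>i\<in>UNIV. Poly_Mapping.single (Poly_Mapping.single i 1) (v i)) ^ d"

definition symmetric_rank :: "nat \<Rightarrow> 'n::finite cpoly \<Rightarrow> nat" where
  "symmetric_rank d F = (LEAST k. \<exists>v. F = (\<Sum>j<k. elementary_sym d (v j)))"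

text \<open>The union is over the representatives \<open>v\<close> of \<open>p\<close>, which all give the same point.\<close>

definition veronese_map ::
  "nat \<Rightarrow> ('n::finite \<Rightarrow> complex) set \<Rightarrow> (('n \<Rightarrow>\<^sub>0 nat) \<Rightarrow> complex) set" where
  "veronese_map d p = (\<Union>v\<in>p. form_point (elementary_sym d v))"

definition veronese_variety :: "nat \<Rightarrow> (('n::finite \<Rightarrow>\<^sub>0 nat) \<Rightarrow> complex) set set" where
  "veronese_variety d = veronese_map d ` proj_space UNIV"

definition sgr :: "'n::finite cpoly \<Rightarrow> int" where
  "sgr F = proj_codim (proj_zeros UNIV (range (\<lambda>i. partial_deriv i F)))"

definition sgr_locus :: "nat \<Rightarrow> nat \<Rightarrow> (('n::finite \<Rightarrow>\<^sub>0 nat) \<Rightarrow> complex) set set" where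
  "sgr_locus d r = {form_point F | F. homogeneous d F \<and> F \<noteq> 0 \<and> sgr F \<le> int r}"

end

theory Submission
  imports Defs "Jordan_Normal_Form.Determinant"
begin

text \<open>Over the complex numbers a quadratic form \<open>F\<close> is a sum \<open>\<Sum>j<m. (v j)\<^sup>2\<close> of squares of linearly
  independent linear forms (lemma \<open>diagonalise\<close>), and everything is read off from such a presentation.
  Independence is carried by vectors dual to the \<open>v j\<close>.

  The partial derivatives of \<open>F\<close> vanish exactly on the linear space where all \<open>v j\<close> vanish, which has
  codimension \<open>m\<close>, so the symmetric geometric rank is \<open>m\<close>. The determinant of the polar form on \<open>r + 1\<close>
  vectors is zero for every sum of \<open>r\<close> squares, but equals \<open>1\<close> for \<open>F\<close> and its dual vectors if \<open>r < m\<close>.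
  So \<open>m\<close> squares are needed and the symmetric rank is \<open>m\<close> too. The same determinants are polynomials in
  the coefficients of the form. Hence the locus of sums of \<open>r\<close> squares, which is the union of the spans
  of \<open>r\<close> points of the Veronese variety, is Zariski closed, and the closure in the definition of the
  secant variety adds nothing to it.

  The dimension of a linear space has to be computed as the maximal length of chains of irreducible
  closed sets. A flag of linear subspaces gives the lower bound. The upper bound uses algebraic
  independence: a form that vanishes on an irreducible set but not on a larger one can be added to a
  family that is algebraically independent on the smaller set, and the result is independent on the
  larger one (lemma \<open>alg_indep_Cons\<close>). A chain in the linear space, continued by a flag up to the whole
  space, therefore yields as many algebraically independent polynomials as it has members. By counting
  monomials there are at most as many of them as variables (lemma \<open>alg_indep_length_le\<close>).\<close>

abbreviation "lookup \<equiv> Poly_Mapping.lookup"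
abbreviation "single \<equiv> Poly_Mapping.single"
abbreviation "keys \<equiv> Poly_Mapping.keys"

section \<open>Evaluation and degree of polynomials\<close>

definition monom_eval :: "('i \<Rightarrow> complex) \<Rightarrow> ('i \<Rightarrow>\<^sub>0 nat) \<Rightarrow> complex" where
  "monom_eval x m = (\<Prod>i\<in>keys m. x i ^ lookup m i)"

text \<open>Enlarging the index sets of the defining products and sums allows two monomials, or two polynomials,
  to be expanded over the same index set; this makes evaluation additive and multiplicative.\<close>

lemma monom_eval_superset:
  "finite I \<Longrightarrow> keys m \<subseteq> I \<Longrightarrow> monom_eval x m = (\<Prod>i\<in>I. x i ^ lookup m i)"
  unfolding monom_eval_def by (rule prod.mono_neutral_left) (auto simp: in_keys_iff)

lemma mon_degree_superset:
  "finite I \<Longrightarrow> keys m \<subseteq> I \<Longrightarrow> mon_degree m = (\<Sum>i\<in>I. lookup m i)"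
  unfolding mon_degree_def by (rule sum.mono_neutral_left) (auto simp: in_keys_iff)

lemma monom_eval_0 [simp]: "monom_eval x 0 = 1"
  by (simp add: monom_eval_def)

lemma monom_eval_single [simp]: "monom_eval x (single i k) = x i ^ k"
  by (simp add: monom_eval_def)

lemma monom_eval_add: "monom_eval x (m + n) = monom_eval x m * monom_eval x n"
proof -
  have "keys (m + n) \<subseteq> keys m \<union> keys n" by (rule keys_add)
  then show ?thesis
    using monom_eval_superset[of "keys m \<union> keys n" "m + n" x]
      monom_eval_superset[of "keys m \<union> keys n" m x] monom_eval_superset[of "keys m \<union> keys n" n x]
    by (simp add: lookup_add power_add prod.distrib)
qed

lemma mon_degree_0 [simp]: "mon_degree 0 = 0"
  by (simp add: mon_degree_def)

lemma mon_degree_single [simp]: "mon_degree (single i k) = k"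
  by (simp add: mon_degree_def)

lemma mon_degree_add: "mon_degree (m + n) = mon_degree m + mon_degree n"
proof -
  have "keys (m + n) \<subseteq> keys m \<union> keys n" by (rule keys_add)
  then show ?thesis
    using mon_degree_superset[of "keys m \<union> keys n" "m + n"]
      mon_degree_superset[of "keys m \<union> keys n" m] mon_degree_superset[of "keys m \<union> keys n" n]
    by (simp add: lookup_add sum.distrib)
qed

lemma lookup_le_mon_degree: "lookup m i \<le> mon_degree m"
proof (cases "i \<in> keys m")
  case True
  then show ?thesis unfolding mon_degree_def by (intro member_le_sum) auto
qed (simp add: in_keys_iff)

lemma monom_eval_scale: "monom_eval (cscale c x) m = c ^ mon_degree m * monom_eval x m"
  by (simp add: monom_eval_def mon_degree_def cscale_def power_mult_distrib prod.distrib power_sum)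

lemma poly_eval_superset:
  assumes "finite M" "keys F \<subseteq> M"
  shows "poly_eval F x = (\<Sum>m\<in>M. lookup F m * monom_eval x m)"
  unfolding poly_eval_def monom_eval_def using assms
  by (intro sum.mono_neutral_left) (auto simp: in_keys_iff)

lemma poly_eval_0 [simp]: "poly_eval 0 x = 0"
  by (simp add: poly_eval_def)

lemma poly_eval_single [simp]: "poly_eval (single m c) x = c * monom_eval x m"
  using poly_eval_superset[of "{m}" "single m c" x] by simp

lemma poly_eval_add: "poly_eval (F + G) x = poly_eval F x + poly_eval G x"
proof -
  have "keys (F + G) \<subseteq> keys F \<union> keys G" by (rule keys_add)
  then show ?thesis
    using poly_eval_superset[of "keys F \<union> keys G" "F + G" x]
      poly_eval_superset[of "keys F \<union> keys G" F x] poly_eval_superset[of "keys F \<union> keys G" G x]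
    by (simp add: lookup_add sum.distrib distrib_right)
qed

lemma poly_eval_sum: "poly_eval (\<Sum>i\<in>I. F i) x = (\<Sum>i\<in>I. poly_eval (F i) x)"
  by (induction I rule: infinite_finite_induct) (auto simp: poly_eval_add)

lemma sum_single_keys: "(\<Sum>m\<in>keys F. single m (lookup F m)) = F"
  by (rule poly_mapping_eqI)
    (auto simp: lookup_sum lookup_single when_def in_keys_iff sum.delta)

lemma poly_eval_mult: "poly_eval (F * G) x = poly_eval F x * poly_eval G x"
proof -
  have "F * G = (\<Sum>m\<in>keys F. single m (lookup F m)) * (\<Sum>n\<in>keys G. single n (lookup G n))"
    by (simp add: sum_single_keys)
  also have "\<dots> = (\<Sum>m\<in>keys F. \<Sum>n\<in>keys G. single (m + n) (lookup F m * lookup G n))"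
    by (simp add: sum_product mult_single)
  finally show ?thesis
    by (simp add: poly_eval_sum monom_eval_add sum_product poly_eval_superset[OF _ order_refl]
        mult.assoc mult.left_commute)
qed

lemma poly_eval_1 [simp]: "poly_eval 1 x = 1"
  using poly_eval_single[of 0 1 x] by simp

lemma poly_eval_power: "poly_eval (F ^ k) x = poly_eval F x ^ k"
  by (induction k) (auto simp: poly_eval_mult)

interpretation poly_eval: comm_ring_hom "\<lambda>F. poly_eval F x"
  by unfold_locales (auto simp: poly_eval_add poly_eval_mult)

lemma homogeneousI: "(\<And>m. lookup F m \<noteq> 0 \<Longrightarrow> mon_degree m = d) \<Longrightarrow> homogeneous d F"
  by (simp add: homogeneous_def in_keys_iff)

lemma homogeneousD: "homogeneous d F \<Longrightarrow> lookup F m \<noteq> 0 \<Longrightarrow> mon_degree m = d"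
  by (simp add: homogeneous_def in_keys_iff)

lemma homogeneous_0 [simp]: "homogeneous d 0"
  by (simp add: homogeneous_def)

lemma homogeneous_single: "mon_degree m = d \<Longrightarrow> homogeneous d (single m c)"
  by (auto intro!: homogeneousI simp: lookup_single when_def split: if_splits)

lemma homogeneous_1: "homogeneous 0 1"
  unfolding single_one[symmetric] by (rule homogeneous_single) simp

lemma homogeneous_add: "homogeneous d F \<Longrightarrow> homogeneous d G \<Longrightarrow> homogeneous d (F + G)"
  using Poly_Mapping.keys_add[of F G] unfolding homogeneous_def by blast

lemma homogeneous_sum: "(\<And>i. i \<in> I \<Longrightarrow> homogeneous d (F i)) \<Longrightarrow> homogeneous d (\<Sum>i\<in>I. F i)"
  by (induction I rule: infinite_finite_induct) (auto intro: homogeneous_add)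

lemma homogeneous_mult:
  "homogeneous d F \<Longrightarrow> homogeneous e G \<Longrightarrow> homogeneous (d + e) (F * G)"
  using keys_mult[of F G] unfolding homogeneous_def by (fastforce simp: mon_degree_add)

lemma homogeneous_power: "homogeneous d F \<Longrightarrow> homogeneous (k * d) (F ^ k)"
  by (induction k) (auto intro: homogeneous_mult homogeneous_1)

lemma homogeneous_prod:
  "(\<And>i. i \<in> I \<Longrightarrow> homogeneous d (F i)) \<Longrightarrow> finite I \<Longrightarrow> homogeneous (card I * d) (\<Prod>i\<in>I. F i)"
  by (induction I rule: infinite_finite_induct) (auto intro: homogeneous_mult homogeneous_1)

lemma homogeneous_diff: "homogeneous d F \<Longrightarrow> homogeneous d G \<Longrightarrow> homogeneous d (F - G)"
proof (rule homogeneousI)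
  fix m assume F: "homogeneous d F" and G: "homogeneous d G" and m: "lookup (F - G) m \<noteq> 0"
  then have "lookup F m \<noteq> 0 \<or> lookup G m \<noteq> 0" by (auto simp: lookup_minus)
  then show "mon_degree m = d" using homogeneousD[OF F] homogeneousD[OF G] by blast
qed

lemma homogeneous_uminus: "homogeneous d F \<Longrightarrow> homogeneous d (- F)"
  using homogeneous_diff[of d 0 F] by simp

lemma poly_eval_scale: "homogeneous d F \<Longrightarrow> poly_eval F (cscale c x) = c ^ d * poly_eval F x"
  by (auto simp: poly_eval_superset[OF _ order_refl] monom_eval_scale sum_distrib_left
      homogeneous_def intro!: sum.cong)

text \<open>On a cone a polynomial vanishes iff its homogeneous parts do. Splitting into parts is what lets
  inhomogeneous relations between homogeneous polynomials be handled with homogeneous tools.\<close>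

definition hom_part :: "nat \<Rightarrow> 'i cpoly \<Rightarrow> 'i cpoly" where
  "hom_part d F = (\<Sum>m\<in>{m \<in> keys F. mon_degree m = d}. single m (lookup F m))"

lemma homogeneous_hom_part: "homogeneous d (hom_part d F)"
  unfolding hom_part_def by (rule homogeneous_sum) (auto intro: homogeneous_single)

lemma sum_hom_part: "(\<Sum>d\<in>mon_degree ` keys F. hom_part d F) = F"
  unfolding hom_part_def by (subst sum.image_gen[symmetric]) (auto simp: sum_single_keys)

text \<open>Restriction to a line turns questions about polynomials on linear spaces into questions about
  polynomials in one variable, which have finitely many roots.\<close>

lemma poly_eval_line: "\<exists>p. \<forall>s. poly p s = poly_eval G (x + cscale s y)"
  by (rule exI[of _ "\<Sum>m\<in>keys G. Polynomial.smult (lookup G m) (\<Prod>i\<in>keys m. [:x i, y i:] ^ lookup m i)"])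
    (simp add: poly_eval_def poly_sum poly_prod cscale_def)

section \<open>Closed sets, cones and irreducibility\<close>

lemma cscale_cscale [simp]: "cscale c (cscale d x) = cscale (c * d) x"
  by (simp add: cscale_def mult.assoc)

lemma cscale_one [simp]: "cscale 1 x = x"
  by (simp add: cscale_def)

lemma cscale_zero_left [simp]: "cscale 0 x = 0"
  by (auto simp: cscale_def)

lemma cscale_zero_right [simp]: "cscale c 0 = 0"
  by (auto simp: cscale_def)

lemma cscale_eq_0_iff [simp]: "cscale c x = 0 \<longleftrightarrow> c = 0 \<or> x = 0"
  by (auto simp: cscale_def fun_eq_iff)

lemma proj_point_self [simp]: "x \<in> proj_point x"
  unfolding proj_point_def by (auto intro!: exI[of _ 1])

lemma proj_point_eq:
  assumes "y \<in> proj_point x"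
  shows "proj_point y = proj_point x"
proof -
  obtain c where c: "c \<noteq> 0" "y = cscale c x" using assms by (auto simp: proj_point_def)
  have "z \<in> proj_point x" if z: "z \<in> proj_point y" for z
  proof -
    obtain d where "d \<noteq> 0" "z = cscale d y" using z by (auto simp: proj_point_def)
    with c show ?thesis unfolding proj_point_def by (intro CollectI exI[of _ "d * c"]) simp
  qed
  moreover have "z \<in> proj_point y" if z: "z \<in> proj_point x" for z
  proof -
    obtain d where "d \<noteq> 0" "z = cscale d x" using z by (auto simp: proj_point_def)
    with c show ?thesis unfolding proj_point_def by (intro CollectI exI[of _ "d / c"]) simp
  qed
  ultimately show ?thesis by blast
qed

lemma in_proj_spaceD:
  assumes "p \<in> proj_space W" "x \<in> p"
  shows "p = proj_point x" "x \<noteq> 0"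
proof -
  obtain v where v: "v \<noteq> 0" "p = proj_point v" using assms by (auto simp: proj_space_def)
  show "p = proj_point x" using proj_point_eq[of x v] assms v by simp
  show "x \<noteq> 0" using assms(2) v by (auto simp: proj_point_def)
qed

lemma in_proj_space_carrier:
  assumes "cfun.subspace W" "p \<in> proj_space W" "x \<in> p"
  shows "x \<in> W"
  using assms by (auto simp: proj_space_def proj_point_def cfun.subspace_scale)

lemma proj_point_in_proj_space:
  assumes "cfun.subspace W" "x \<noteq> 0"
  shows "proj_point x \<in> proj_space W \<longleftrightarrow> x \<in> W"
  using in_proj_space_carrier[OF assms(1), of "proj_point x" x] assms(2)
  by (auto simp: proj_space_def)

lemma proj_space_nonempty_point: "p \<in> proj_space W \<Longrightarrow> \<exists>x. x \<in> p"
  by (auto simp: proj_space_def intro: proj_point_self)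

lemma poly_eval_proj_point:
  assumes "homogeneous d G" "poly_eval G x = 0" "y \<in> proj_point x"
  shows "poly_eval G y = 0"
  using assms by (auto simp: proj_point_def poly_eval_scale)

text \<open>The polynomials vanishing on \<open>S\<close> serve as equations, so it suffices to separate each point
  outside \<open>S\<close> by one of them.\<close>

lemma zariski_closedI:
  assumes "S \<subseteq> proj_space W"
    and "\<And>p. p \<in> proj_space W \<Longrightarrow> p \<notin> S \<Longrightarrow>
      \<exists>d G. homogeneous d G \<and> (\<forall>q\<in>S. \<forall>x\<in>q. poly_eval G x = 0) \<and> (\<exists>x\<in>p. poly_eval G x \<noteq> 0)"
  shows "zariski_closed W S"
  unfolding zariski_closed_def
proof (intro exI conjI)
  let ?A = "{G. (\<exists>e. homogeneous e G) \<and> (\<forall>q\<in>S. \<forall>x\<in>q. poly_eval G x = 0)}"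
  show "\<forall>G\<in>?A. \<exists>e. homogeneous e G" by blast
  show "S = proj_zeros W ?A"
  proof
    show "S \<subseteq> proj_zeros W ?A" using assms(1) by (auto simp: proj_zeros_def)
    show "proj_zeros W ?A \<subseteq> S" using assms(2) unfolding proj_zeros_def by blast
  qed
qed

lemma zariski_closed_subset: "zariski_closed W S \<Longrightarrow> S \<subseteq> proj_space W"
  by (auto simp: zariski_closed_def proj_zeros_def)

lemma zariski_closed_separate:
  assumes "zariski_closed W S" "p \<in> proj_space W" "p \<notin> S"
  obtains d G x where "homogeneous d G" "\<And>q y. q \<in> S \<Longrightarrow> y \<in> q \<Longrightarrow> poly_eval G y = 0"
    "x \<in> p" "poly_eval G x \<noteq> 0"
proof -
  obtain A where A: "\<forall>G\<in>A. \<exists>e. homogeneous e G" "S = proj_zeros W A"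
    using assms(1) by (auto simp: zariski_closed_def)
  obtain G x where G: "G \<in> A" "x \<in> p" "poly_eval G x \<noteq> 0"
    using assms A(2) by (auto simp: proj_zeros_def)
  obtain e where "homogeneous e G" using A(1) G(1) by blast
  moreover have "poly_eval G y = 0" if "q \<in> S" "y \<in> q" for q y
    using that G(1) A(2) by (auto simp: proj_zeros_def)
  ultimately show thesis using G(2,3) by (rule that)
qed

lemma zariski_closed_zeros:
  assumes "zariski_closed W Z" "homogeneous d G"
  shows "zariski_closed W {p \<in> Z. \<forall>x\<in>p. poly_eval G x = 0}"
proof -
  obtain A where A: "\<forall>G\<in>A. \<exists>e. homogeneous e G" "Z = proj_zeros W A"
    using assms(1) by (auto simp: zariski_closed_def)
  have "{p \<in> Z. \<forall>x\<in>p. poly_eval G x = 0} = proj_zeros W (insert G A)"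
    by (auto simp: A proj_zeros_def)
  moreover have "\<forall>G\<in>insert G A. \<exists>e. homogeneous e G"
    using A(1) assms(2) by blast
  ultimately show ?thesis unfolding zariski_closed_def by blast
qed

lemma irreducible_closedD:
  assumes "irreducible_closed W Z"
  shows "zariski_closed W Z" "Z \<noteq> {}" "Z \<subseteq> proj_space W"
  using assms zariski_closed_subset[of W Z] unfolding irreducible_closed_def by simp_all

text \<open>The origin is adjoined, so that the affine cone over the empty set is \<open>{0}\<close> and chains of
  irreducible sets can start there.\<close>

definition affine_cone :: "('i \<Rightarrow> complex) set set \<Rightarrow> ('i \<Rightarrow> complex) set" where
  "affine_cone Z = insert 0 (\<Union>Z)"

lemma affine_cone_mono: "Z \<subseteq> Z' \<Longrightarrow> affine_cone Z \<subseteq> affine_cone Z'"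
  by (auto simp: affine_cone_def)

lemma affine_cone_scale:
  assumes "Z \<subseteq> proj_space W" "x \<in> affine_cone Z"
  shows "cscale c x \<in> affine_cone Z"
proof (cases "c = 0 \<or> x = 0")
  case True
  then show ?thesis by (auto simp: affine_cone_def)
next
  case False
  then obtain p where p: "p \<in> Z" "x \<in> p" using assms(2) by (auto simp: affine_cone_def)
  then have "p = proj_point x" using assms(1) in_proj_spaceD by blast
  with False have "cscale c x \<in> p" by (auto simp: proj_point_def)
  with p show ?thesis by (auto simp: affine_cone_def)
qed

lemma affine_cone_proj_space:
  assumes "cfun.subspace V"
  shows "affine_cone (proj_space V) = V"
proof
  show "affine_cone (proj_space V) \<subseteq> V"
    using in_proj_space_carrier[OF assms] cfun.subspace_0[OF assms] by (auto simp: affine_cone_def)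
  show "V \<subseteq> affine_cone (proj_space V)"
    by (auto simp: affine_cone_def proj_space_def intro: proj_point_self)
qed

text \<open>Homogeneity carries the vanishing over to the origin: a form of positive degree vanishes there
  anyway, and a form of degree \<open>0\<close> is constant, hence zero as soon as \<open>Z\<close> has a point.\<close>

lemma poly_eval_affine_cone:
  assumes "homogeneous d G" "Z \<subseteq> proj_space W" "Z \<noteq> {}"
    and "\<And>p x. p \<in> Z \<Longrightarrow> x \<in> p \<Longrightarrow> poly_eval G x = 0" "x \<in> affine_cone Z"
  shows "poly_eval G x = 0"
proof (cases "x = 0")
  case True
  obtain p where p: "p \<in> Z" using assms(3) by blast
  then obtain y where y: "y \<in> p" using assms(2) proj_space_nonempty_point by blast
  have "poly_eval G (cscale 0 y) = 0 ^ d * poly_eval G y"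
    by (rule poly_eval_scale[OF assms(1)])
  with assms(4)[OF p y] True show ?thesis by simp
next
  case False
  with assms(4,5) show ?thesis by (auto simp: affine_cone_def)
qed

text \<open>The homogeneous elements of the vanishing ideal of \<open>C\<close> satisfy the condition for a prime ideal.\<close>

definition graded_prime :: "('i \<Rightarrow> complex) set \<Rightarrow> bool" where
  "graded_prime C \<longleftrightarrow> (\<forall>d e G H. homogeneous d G \<longrightarrow> homogeneous e H \<longrightarrow>
     (\<forall>x\<in>C. poly_eval G x * poly_eval H x = 0) \<longrightarrow>
     (\<forall>x\<in>C. poly_eval G x = 0) \<or> (\<forall>x\<in>C. poly_eval H x = 0))"

text \<open>If \<open>G H\<close> vanishes on \<open>Z\<close>, then \<open>Z\<close> is the union of its closed subsets \<open>G = 0\<close> and \<open>H = 0\<close>.\<close>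

lemma graded_prime_affine_cone:
  assumes "irreducible_closed W Z"
  shows "graded_prime (affine_cone Z)"
  unfolding graded_prime_def
proof (intro allI impI)
  fix d e and G H :: "'a cpoly"
  assume G: "homogeneous d G" and H: "homogeneous e H"
    and GH: "\<forall>x\<in>affine_cone Z. poly_eval G x * poly_eval H x = 0"
  let ?Z = "\<lambda>G. {p \<in> Z. \<forall>x\<in>p. poly_eval G x = 0}"
  note Z = irreducible_closedD[OF assms]
  have irr: "Z = Z1 \<or> Z = Z2" if "zariski_closed W Z1" "zariski_closed W Z2" "Z = Z1 \<union> Z2" for Z1 Z2
    using assms that unfolding irreducible_closed_def by simp
  have "p \<in> ?Z G \<union> ?Z H" if p: "p \<in> Z" for p
  proof -
    obtain x where x: "x \<in> p" using p Z(3) proj_space_nonempty_point by blast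
    have "poly_eval G x = 0 \<or> poly_eval H x = 0"
      using GH p x by (auto simp: affine_cone_def)
    moreover have "p = proj_point x" using in_proj_spaceD p x Z(3) by blast
    ultimately show ?thesis
      using poly_eval_proj_point[OF G, of x] poly_eval_proj_point[OF H, of x] p by auto
  qed
  then have "Z \<subseteq> ?Z G \<union> ?Z H" by (rule subsetI)
  moreover have "?Z G \<union> ?Z H \<subseteq> Z" by simp
  ultimately have "Z = ?Z G \<union> ?Z H" by (rule subset_antisym)
  then have "Z = ?Z G \<or> Z = ?Z H"
    by (rule irr[OF zariski_closed_zeros[OF Z(1) G] zariski_closed_zeros[OF Z(1) H]])
  then have "Z \<subseteq> ?Z G \<or> Z \<subseteq> ?Z H"
    by (rule disj_forward) (rule equalityD1, assumption)+
  then show "(\<forall>x\<in>affine_cone Z. poly_eval G x = 0) \<or> (\<forall>x\<in>affine_cone Z. poly_eval H x = 0)"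
  proof
    assume "Z \<subseteq> ?Z G"
    then have "poly_eval G x = 0" if "p \<in> Z" "x \<in> p" for p x using that by auto
    from poly_eval_affine_cone[OF G Z(3,2) this] show ?thesis by simp
  next
    assume "Z \<subseteq> ?Z H"
    then have "poly_eval H x = 0" if "p \<in> Z" "x \<in> p" for p x using that by auto
    from poly_eval_affine_cone[OF H Z(3,2) this] show ?thesis by simp
  qed
qed

text \<open>Linear spaces have prime vanishing ideals: if \<open>G\<close> is nonzero at \<open>x\<close> and \<open>H\<close> at \<open>y\<close>, then both are
  nonzero polynomials on the line through \<open>x\<close> and \<open>y\<close>, and so is their product.\<close>

lemma poly_eval_mult_eq_0_subspace:
  assumes V: "cfun.subspace V" and GH: "\<And>x. x \<in> V \<Longrightarrow> poly_eval G x * poly_eval H x = 0"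
  shows "(\<forall>x\<in>V. poly_eval G x = 0) \<or> (\<forall>x\<in>V. poly_eval H x = 0)"
proof (rule ccontr)
  assume "\<not> ?thesis"
  then obtain x y where x: "x \<in> V" "poly_eval G x \<noteq> 0" and y: "y \<in> V" "poly_eval H y \<noteq> 0"
    by blast
  obtain p where p: "\<forall>s. poly p s = poly_eval G (x + cscale s (y - x))"
    using poly_eval_line by blast
  obtain q where q: "\<forall>s. poly q s = poly_eval H (x + cscale s (y - x))"
    using poly_eval_line by blast
  have "x + cscale s (y - x) \<in> V" for s
    using V x(1) y(1) by (intro cfun.subspace_add cfun.subspace_scale cfun.subspace_diff)
  then have "poly (p * q) s = 0" for s using GH p q by simp
  then have "p * q = 0" using poly_all_0_iff_0 by blast
  moreover have "poly p 0 \<noteq> 0" using p x by simp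
  moreover have "poly q 1 \<noteq> 0" using q y by simp
  ultimately show False by auto
qed

lemma irreducible_closed_subspace:
  assumes V: "cfun.subspace V" and cl: "zariski_closed W (proj_space V)" and ne: "x \<in> V" "x \<noteq> 0"
  shows "irreducible_closed W (proj_space V)"
  unfolding irreducible_closed_def
proof (intro conjI allI impI)
  show "zariski_closed W (proj_space V)" by fact
  show "proj_space V \<noteq> {}" using ne by (auto simp: proj_space_def)
  fix Z1 Z2
  assume Z: "zariski_closed W Z1" "zariski_closed W Z2" and eq: "proj_space V = Z1 \<union> Z2"
  show "proj_space V = Z1 \<or> proj_space V = Z2"
  proof (rule ccontr)
    assume neq: "\<not> ?thesis"
    have Z12: "Z1 \<subseteq> proj_space V" "Z2 \<subseteq> proj_space V" unfolding eq by simp_all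
    with neq obtain p1 p2 where p: "p1 \<in> proj_space V" "p1 \<notin> Z1" "p2 \<in> proj_space V" "p2 \<notin> Z2"
      by (meson subset_antisym subsetI)
    have sub: "proj_space V \<subseteq> proj_space W" by (rule zariski_closed_subset[OF cl])
    obtain d G x1 where G: "homogeneous d G"
      "\<And>q y. q \<in> Z1 \<Longrightarrow> y \<in> q \<Longrightarrow> poly_eval G y = 0" "x1 \<in> p1" "poly_eval G x1 \<noteq> 0"
      using zariski_closed_separate[OF Z(1) subsetD[OF sub p(1)] p(2)] by blast
    obtain e H x2 where H: "homogeneous e H"
      "\<And>q y. q \<in> Z2 \<Longrightarrow> y \<in> q \<Longrightarrow> poly_eval H y = 0" "x2 \<in> p2" "poly_eval H x2 \<noteq> 0"
      using zariski_closed_separate[OF Z(2) subsetD[OF sub p(3)] p(4)] by blast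
    have "Z1 \<noteq> {}"
    proof
      assume "Z1 = {}"
      then have "proj_space V = Z2" using eq by simp
      with neq show False by simp
    qed
    note Z1 = this Z12(1)
    have "poly_eval G x * poly_eval H x = 0" if "x \<in> V" for x
    proof (cases "x = 0")
      case True
      have "poly_eval G 0 = 0"
        by (rule poly_eval_affine_cone[OF G(1) Z1(2,1) G(2)]) (auto simp: affine_cone_def)
      then show ?thesis using True by simp
    next
      case False
      then have "proj_point x \<in> proj_space V" using that by (auto simp: proj_space_def)
      then have "proj_point x \<in> Z1 \<union> Z2" unfolding eq .
      then show ?thesis using G(2)[OF _ proj_point_self] H(2)[OF _ proj_point_self] by auto
    qed
    from poly_eval_mult_eq_0_subspace[OF V this]
    have "(\<forall>x\<in>V. poly_eval G x = 0) \<or> (\<forall>x\<in>V. poly_eval H x = 0)" .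
    moreover have "x1 \<in> V" by (rule in_proj_space_carrier[OF V p(1) G(3)])
    moreover have "x2 \<in> V" by (rule in_proj_space_carrier[OF V p(3) H(3)])
    ultimately show False using G(4) H(4) by blast
  qed
qed

section \<open>Algebraic independence and chains of irreducible sets\<close>

text \<open>The monomial in the entries of \<open>fs\<close> with exponent vector \<open>a\<close>. Lists make it possible to adjoin a
  further polynomial at the front.\<close>

definition power_prod :: "'a::comm_monoid_mult list \<Rightarrow> nat list \<Rightarrow> 'a" where
  "power_prod fs a = prod_list (map2 (^) fs a)"

lemma power_prod_Cons: "power_prod (f # fs) (b # a) = f ^ b * power_prod fs a"
  by (simp add: power_prod_def)

definition exponents :: "nat \<Rightarrow> nat \<Rightarrow> nat list set" where
  "exponents s D = {a. set a \<subseteq> {..D} \<and> length a = s}"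

lemma exponents_0 [simp]: "exponents 0 D = {[]}"
  by (auto simp: exponents_def)

lemma finite_exponents [simp]: "finite (exponents s D)"
  by (simp add: exponents_def finite_lists_length_eq)

lemma card_exponents: "card (exponents s D) = Suc D ^ s"
  by (simp add: exponents_def card_lists_length_eq)

lemma exponents_Suc: "exponents (Suc s) D = (\<lambda>(b, a). b # a) ` ({..D} \<times> exponents s D)"
  by (auto simp: exponents_def length_Suc_conv image_iff)

lemma sum_exponents_Suc:
  "(\<Sum>a\<in>exponents (Suc s) D. g a) = (\<Sum>b\<le>D. \<Sum>a\<in>exponents s D. g (b # a))"
  unfolding exponents_Suc
  by (subst sum.reindex) (auto simp: inj_on_def sum.cartesian_product intro!: sum.cong)

text \<open>Algebraic independence of the restrictions to \<open>C\<close>: no nontrivial polynomial relation, here with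
  exponents bounded by an arbitrary \<open>D\<close>, holds between the values on \<open>C\<close>.\<close>

definition alg_indep :: "'i cpoly list \<Rightarrow> ('i \<Rightarrow> complex) set \<Rightarrow> bool" where
  "alg_indep fs C \<longleftrightarrow> (\<forall>D c.
     (\<forall>x\<in>C. (\<Sum>a\<in>exponents (length fs) D. c a * poly_eval (power_prod fs a) x) = 0) \<longrightarrow>
     (\<forall>a\<in>exponents (length fs) D. c a = 0))"

lemma alg_indep_mono: "alg_indep fs C \<Longrightarrow> C \<subseteq> C' \<Longrightarrow> alg_indep fs C'"
  unfolding alg_indep_def by (meson subsetD)

lemma alg_indep_Nil: "x \<in> C \<Longrightarrow> alg_indep [] C"
  by (auto simp: alg_indep_def power_prod_def)

text \<open>A form \<open>g\<close> that is not zero on \<open>C\<close> can be cancelled even from an inhomogeneous \<open>h\<close>. Along a ray of the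
  cone \<open>C\<close> where \<open>g\<close> is nonzero, \<open>h\<close> is a polynomial in the scaling factor with the values of its
  homogeneous parts as coefficients. It has infinitely many roots, so \<open>g\<close> times each part is zero on
  \<open>C\<close>, and primeness applies to the parts.\<close>

lemma graded_prime_cancel:
  assumes scale: "\<And>c x. x \<in> C \<Longrightarrow> cscale c x \<in> C" and prime: "graded_prime C"
    and g: "homogeneous e g" "x0 \<in> C" "poly_eval g x0 \<noteq> 0"
    and gh: "\<And>x. x \<in> C \<Longrightarrow> poly_eval g x * poly_eval h x = 0" and x: "x \<in> C"
  shows "poly_eval h x = 0"
proof -
  let ?D = "mon_degree ` keys h"
  have part: "poly_eval g y * poly_eval (hom_part d h) y = 0" if y: "y \<in> C" and d: "d \<in> ?D" for y d
  proof (cases "poly_eval g y = 0")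
    case False
    let ?p = "\<Sum>d\<in>?D. Polynomial.monom (poly_eval (hom_part d h) y) d"
    have p: "poly ?p t = poly_eval h (cscale t y)" for t
    proof -
      have "poly_eval h (cscale t y) = poly_eval (\<Sum>d\<in>?D. hom_part d h) (cscale t y)"
        by (simp only: sum_hom_part)
      also have "\<dots> = poly ?p t"
        by (simp add: poly_eval_sum poly_eval_scale[OF homogeneous_hom_part] poly_sum poly_monom
            mult.commute)
      finally show ?thesis by simp
    qed
    \<comment> \<open>The factor \<open>t\<close> takes care of \<open>t = 0\<close>, where the values of \<open>g\<close> say nothing.\<close>
    have "poly ([:0, 1:] * ?p) t = 0" for t
    proof (cases "t = 0")
      case False
      have "poly_eval g (cscale t y) \<noteq> 0"
        using False \<open>poly_eval g y \<noteq> 0\<close> by (simp add: poly_eval_scale[OF g(1)])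
      then have "poly_eval h (cscale t y) = 0" using gh[OF scale[OF y, of t]] by simp
      then show ?thesis using p[of t] by simp
    qed simp
    then have "[:0, 1:] * ?p = 0" using poly_all_0_iff_0 by blast
    then have "?p = 0" by simp
    then have "coeff ?p d = 0" by simp
    moreover have "coeff ?p d = poly_eval (hom_part d h) y"
      using d by (simp add: coeff_sum sum.delta)
    ultimately show ?thesis by simp
  qed simp
  have "poly_eval (hom_part d h) x = 0" if d: "d \<in> ?D" for d
  proof -
    have "(\<forall>y\<in>C. poly_eval g y = 0) \<or> (\<forall>y\<in>C. poly_eval (hom_part d h) y = 0)"
      using prime g(1) homogeneous_hom_part[of d h] part[OF _ d] unfolding graded_prime_def by blast
    with g(2,3) x show ?thesis by blast
  qed
  then have "poly_eval (\<Sum>d\<in>?D. hom_part d h) x = 0"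
    by (simp add: poly_eval_sum)
  then show ?thesis by (simp only: sum_hom_part)
qed

text \<open>The step that makes dimension grow: enlarging \<open>C\<close> to \<open>C'\<close> costs the equation \<open>g = 0\<close>, and \<open>g\<close> becomes
  a new independent element. A relation on \<open>C'\<close> is a polynomial in \<open>g\<close> with coefficients \<open>R b\<close> in the
  old elements. After division by the largest power of \<open>g\<close> that it contains, restricting to \<open>C\<close> leaves
  only the lowest coefficient, which is a relation on \<open>C\<close> and therefore trivial.\<close>

lemma alg_indep_Cons:
  assumes indep: "alg_indep fs C" and sub: "C \<subseteq> C'"
    and scale: "\<And>c x. x \<in> C' \<Longrightarrow> cscale c x \<in> C'" and prime: "graded_prime C'"
    and g: "homogeneous e g" "x0 \<in> C'" "poly_eval g x0 \<noteq> 0"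
    and g0: "\<And>x. x \<in> C \<Longrightarrow> poly_eval g x = 0"
  shows "alg_indep (g # fs) C'"
  unfolding alg_indep_def
proof (intro allI impI)
  fix D c
  let ?s = "length fs"
  define R where "R b = (\<Sum>a\<in>exponents ?s D. single 0 (c (b # a)) * power_prod fs a)" for b
  have R: "poly_eval (R b) x = (\<Sum>a\<in>exponents ?s D. c (b # a) * poly_eval (power_prod fs a) x)" for b x
    by (simp add: R_def poly_eval_sum poly_eval_mult)
  assume "\<forall>x\<in>C'. (\<Sum>a\<in>exponents (length (g # fs)) D. c a * poly_eval (power_prod (g # fs) a) x) = 0"
  then have rel: "(\<Sum>b\<le>D. poly_eval g x ^ b * poly_eval (R b) x) = 0" if "x \<in> C'" for x
    using that by (simp add: sum_exponents_Suc power_prod_Cons poly_eval_mult poly_eval_power R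
        sum_distrib_left mult.left_commute)
  have zero: "b \<le> D \<Longrightarrow> \<forall>a\<in>exponents ?s D. c (b # a) = 0" for b
  proof (induction b rule: less_induct)
    case (less b)
    define h where "h = (\<Sum>b'\<in>{b..D}. g ^ (b' - b) * R b')"
    have small: "R b' = 0" if "b' < b" for b'
      using less that by (simp add: R_def)
    have gh: "poly_eval (g ^ b) x * poly_eval h x = 0" if "x \<in> C'" for x
    proof -
      have "poly_eval (g ^ b) x * poly_eval h x
          = (\<Sum>b'\<in>{b..D}. poly_eval g x ^ b' * poly_eval (R b') x)"
        by (auto simp: h_def poly_eval_sum poly_eval_mult poly_eval_power sum_distrib_left
            mult.assoc[symmetric] power_add[symmetric] intro!: sum.cong)
      also have "\<dots> = (\<Sum>b'\<le>D. poly_eval g x ^ b' * poly_eval (R b') x)"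
        by (rule sum.mono_neutral_left) (auto simp: small)
      finally show ?thesis using rel[OF that] by simp
    qed
    have h0: "poly_eval h x = 0" if "x \<in> C'" for x
      by (rule graded_prime_cancel[OF scale prime homogeneous_power[OF g(1)] g(2) _ gh that])
        (simp_all add: poly_eval_power g(3))
    have "poly_eval (R b) x = 0" if "x \<in> C" for x
    proof -
      have "poly_eval h x = (\<Sum>b'\<in>{b..D}. 0 ^ (b' - b) * poly_eval (R b') x)"
        by (simp add: h_def poly_eval_sum poly_eval_mult poly_eval_power g0[OF that])
      also have "\<dots> = (\<Sum>b'\<in>{b..D}. if b' = b then poly_eval (R b') x else 0)"
        by (rule sum.cong) auto
      finally show ?thesis using h0 that sub less.prems by (auto simp: sum.delta)
    qed
    then show ?case using indep[unfolded alg_indep_def, rule_format, of "\<lambda>a. c (b # a)" D]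
      by (simp add: R)
  qed
  then show "\<forall>a\<in>exponents (length (g # fs)) D. c a = 0"
    by (auto simp: exponents_Suc)
qed

text \<open>Gaussian elimination: an unknown \<open>a0\<close> that occurs in equation \<open>b\<close> is eliminated from the others.\<close>

lemma homogeneous_system_nontrivial_solution:
  fixes M :: "'a \<Rightarrow> 'b \<Rightarrow> complex"
  assumes "finite B" "finite A" "card B < card A"
  shows "\<exists>c. (\<exists>a\<in>A. c a \<noteq> 0) \<and> (\<forall>b\<in>B. (\<Sum>a\<in>A. c a * M a b) = 0)"
  using assms
proof (induction B arbitrary: A M rule: finite_induct)
  case empty
  then obtain a where "a \<in> A" by fastforce
  then show ?case by (intro exI[of _ "\<lambda>_. 1"]) auto
next
  case (insert b B)
  show ?case
  proof (cases "\<forall>a\<in>A. M a b = 0")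
    case True
    have "card B < card A" using insert by simp
    then obtain c where "\<exists>a\<in>A. c a \<noteq> 0" "\<forall>b\<in>B. (\<Sum>a\<in>A. c a * M a b) = 0"
      using insert.IH[of A M] insert.prems by blast
    with True show ?thesis by (intro exI[of _ c]) auto
  next
    case False
    then obtain a0 where a0: "a0 \<in> A" "M a0 b \<noteq> 0" by blast
    let ?A = "A - {a0}"
    let ?M = "\<lambda>a b'. M a b' - M a b / M a0 b * M a0 b'"
    have "card B < card ?A" using insert a0 by simp
    then obtain c where c: "\<exists>a\<in>?A. c a \<noteq> 0" "\<forall>b'\<in>B. (\<Sum>a\<in>?A. c a * ?M a b') = 0"
      using insert.IH[of ?A ?M] insert.prems by blast
    define c' where "c' = c(a0 := - (\<Sum>a\<in>?A. c a * M a b) / M a0 b)"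
    have sum: "(\<Sum>a\<in>A. c' a * M a b') = (\<Sum>a\<in>?A. c a * ?M a b')" for b'
    proof -
      have "(\<Sum>a\<in>A. c' a * M a b') = c' a0 * M a0 b' + (\<Sum>a\<in>?A. c' a * M a b')"
        using insert.prems a0 by (simp add: sum.remove)
      also have "(\<Sum>a\<in>?A. c' a * M a b') = (\<Sum>a\<in>?A. c a * M a b')"
        by (rule sum.cong) (auto simp: c'_def)
      also have "c' a0 * M a0 b' = - (\<Sum>a\<in>?A. c a * (M a b / M a0 b * M a0 b'))"
        by (simp add: c'_def sum_distrib_right sum_divide_distrib mult.assoc)
      finally show ?thesis
        by (simp add: sum_subtractf right_diff_distrib)
    qed
    have "(\<Sum>a\<in>A. c' a * M a b') = 0" if "b' \<in> insert b B" for b'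
    proof (cases "b' = b")
      case True
      then show ?thesis unfolding sum using a0(2) by simp
    next
      case False
      then show ?thesis unfolding sum using c(2) that by blast
    qed
    moreover have "\<exists>a\<in>A. c' a \<noteq> 0" using c(1) by (auto simp: c'_def)
    ultimately show ?thesis by blast
  qed
qed

definition degree_le :: "nat \<Rightarrow> 'i cpoly \<Rightarrow> bool" where
  "degree_le d F \<longleftrightarrow> (\<forall>m\<in>keys F. mon_degree m \<le> d)"

lemma degree_le_1: "degree_le d 1"
  by (simp add: degree_le_def)

lemma degree_le_mult: "degree_le d F \<Longrightarrow> degree_le e G \<Longrightarrow> degree_le (d + e) (F * G)"
  using keys_mult[of F G] unfolding degree_le_def by (fastforce simp: mon_degree_add intro: add_mono)

lemma degree_le_weaken: "degree_le d F \<Longrightarrow> d \<le> e \<Longrightarrow> degree_le e F"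
  unfolding degree_le_def by (meson order_trans)

lemma degree_le_power: "degree_le d F \<Longrightarrow> degree_le (k * d) (F ^ k)"
  by (induction k) (auto intro: degree_le_mult degree_le_1)

lemma degree_le_power_prod:
  assumes "\<And>f. f \<in> set fs \<Longrightarrow> degree_le e f" "a \<in> exponents (length fs) D"
  shows "degree_le (length fs * (D * e)) (power_prod fs a)"
  using assms
proof (induction fs arbitrary: a)
  case Nil
  then show ?case by (simp add: power_prod_def degree_le_1)
next
  case (Cons f fs)
  from Cons.prems(2) obtain b a' where a: "a = b # a'" "b \<le> D" "a' \<in> exponents (length fs) D"
    by (auto simp: exponents_Suc)
  have "degree_le (D * e) (f ^ b)"
    using degree_le_power[of e f b] Cons.prems(1)[of f] a(2)
    by (auto elim!: degree_le_weaken)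
  from degree_le_mult[OF this Cons.IH[OF Cons.prems(1) a(3)]]
  show ?case by (simp add: a(1) power_prod_Cons)
qed

lemma finite_card_degree_le:
  fixes d :: nat
  defines "M \<equiv> {m :: 'n::finite \<Rightarrow>\<^sub>0 nat. mon_degree m \<le> d}"
  shows "finite M" "card M \<le> Suc d ^ CARD('n)"
proof -
  let ?P = "PiE UNIV (\<lambda>_::'n. {..d})"
  have inj: "inj_on lookup M" by (intro inj_onI poly_mapping_eqI) simp
  have sub: "lookup ` M \<subseteq> ?P"
    by (auto simp: M_def intro: order_trans[OF lookup_le_mon_degree])
  have fin: "finite ?P" by (simp add: finite_PiE)
  show "finite M" using finite_imageD[OF finite_subset[OF sub fin] inj] .
  have "card M = card (lookup ` M)" using card_image[OF inj] by simp
  also have "\<dots> \<le> card ?P" by (rule card_mono[OF fin sub])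
  also have "card ?P = Suc d ^ CARD('n)" by (simp add: card_PiE)
  finally show "card M \<le> Suc d ^ CARD('n)" .
qed

text \<open>The \<open>(D + 1) ^ s\<close> monomials in \<open>s\<close> polynomials of degree at most \<open>e\<close> lie in the space of polynomials
  of degree at most \<open>s D e\<close>, whose dimension grows only like \<open>D ^ N\<close> in \<open>N\<close> variables. For \<open>s > N\<close> and
  large \<open>D\<close> they are linearly dependent.\<close>

lemma alg_indep_length_le:
  fixes fs :: "'n::finite cpoly list"
  assumes indep: "alg_indep fs C"
  shows "length fs \<le> CARD('n)"
proof (rule ccontr)
  let ?s = "length fs" and ?N = "CARD('n)"
  assume "\<not> ?thesis"
  then have s: "?s \<ge> Suc ?N" by simp
  define e where "e = Max (insert 0 (mon_degree ` (\<Union>f\<in>set fs. keys f)))"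
  have e: "degree_le e f" if "f \<in> set fs" for f
    unfolding degree_le_def e_def using that by (auto intro!: Max_ge)
  \<comment> \<open>With \<open>s \<ge> N + 1\<close>, this \<open>D\<close> ensures \<open>(s D e + 1) ^ N < (D + 1) ^ s\<close>.\<close>
  define D where "D = Suc (?s * e) ^ ?N"
  define M where "M = {m :: 'n \<Rightarrow>\<^sub>0 nat. mon_degree m \<le> ?s * (D * e)}"
  have M: "finite M" "card M \<le> Suc (?s * (D * e)) ^ ?N"
    unfolding M_def by (rule finite_card_degree_le)+
  have "Suc (?s * (D * e)) \<le> Suc (?s * e) * Suc D" by simp
  then have "Suc (?s * (D * e)) ^ ?N \<le> (Suc (?s * e) * Suc D) ^ ?N" by (rule power_mono) simp
  also have "\<dots> = D * Suc D ^ ?N" by (simp only: power_mult_distrib D_def)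
  also have "\<dots> < Suc D ^ Suc ?N" by simp
  also have "\<dots> \<le> Suc D ^ ?s" using s by (intro power_increasing) auto
  finally have "card M < card (exponents ?s D)" using M(2) by (simp add: card_exponents)
  from homogeneous_system_nontrivial_solution[OF M(1) finite_exponents this,
      of "\<lambda>a m. lookup (power_prod fs a) m"]
  obtain c where c: "\<exists>a\<in>exponents ?s D. c a \<noteq> 0"
    "\<forall>m\<in>M. (\<Sum>a\<in>exponents ?s D. c a * lookup (power_prod fs a) m) = 0" by blast
  have "(\<Sum>a\<in>exponents ?s D. c a * poly_eval (power_prod fs a) x) = 0" for x
  proof -
    have "(\<Sum>a\<in>exponents ?s D. c a * poly_eval (power_prod fs a) x)
        = (\<Sum>a\<in>exponents ?s D. \<Sum>m\<in>M. c a * lookup (power_prod fs a) m * monom_eval x m)"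
    proof (rule sum.cong[OF refl])
      fix a assume "a \<in> exponents ?s D"
      from degree_le_power_prod[OF e this] have "keys (power_prod fs a) \<subseteq> M"
        by (auto simp: degree_le_def M_def)
      then show "c a * poly_eval (power_prod fs a) x
          = (\<Sum>m\<in>M. c a * lookup (power_prod fs a) m * monom_eval x m)"
        by (simp add: poly_eval_superset[OF M(1)] sum_distrib_left mult.assoc)
    qed
    also have "\<dots> = (\<Sum>m\<in>M. (\<Sum>a\<in>exponents ?s D. c a * lookup (power_prod fs a) m) * monom_eval x m)"
      by (subst sum.swap) (simp add: sum_distrib_right)
    also have "\<dots> = 0" using c(2) by simp
    finally show ?thesis .
  qed
  with indep c(1) show False unfolding alg_indep_def by blast
qed

text \<open>Each strict inclusion of irreducible sets supplies a form vanishing on the smaller but not on the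
  larger set, hence one more algebraically independent element. The cone \<open>{0}\<close> below the chain accounts
  for its first member.\<close>

lemma chain_alg_indep:
  assumes "\<And>j. j < k \<Longrightarrow> irreducible_closed W (Z j)" "\<And>j. Suc j < k \<Longrightarrow> Z j \<subset> Z (Suc j)"
  shows "\<exists>fs. length fs = k \<and> alg_indep fs (if k = 0 then {0} else affine_cone (Z (k - 1)))"
  using assms
proof (induction k)
  case 0
  then show ?case using alg_indep_Nil by auto
next
  case (Suc k)
  let ?C = "if k = 0 then {0} else affine_cone (Z (k - 1))"
  have "\<exists>fs. length fs = k \<and> alg_indep fs ?C"
    by (rule Suc.IH) (simp_all add: Suc.prems)
  then obtain fs where fs: "length fs = k" "alg_indep fs ?C" by blast
  have irr: "irreducible_closed W (Z k)" using Suc.prems(1)[of k] by simp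
  note cl = irreducible_closedD(3,2)[OF irr]
  have "\<exists>e g x0. homogeneous e g \<and> x0 \<in> affine_cone (Z k) \<and> poly_eval g x0 \<noteq> 0 \<and>
      (\<forall>x\<in>?C. poly_eval g x = 0)"
  proof (cases k)
    case 0
    obtain p where p: "p \<in> Z k" using cl(2) by blast
    then obtain x where x: "x \<in> p" using cl(1) proj_space_nonempty_point by blast
    then have "x \<noteq> 0" using in_proj_spaceD p cl(1) by blast
    \<comment> \<open>A coordinate that is nonzero somewhere on \<open>Z 0\<close> vanishes on the cone \<open>{0}\<close>.\<close>
    then obtain i where "x i \<noteq> 0" by (auto simp: fun_eq_iff)
    then show ?thesis using p x 0
      by (intro exI[of _ 1] exI[of _ "single (single i 1) 1"] exI[of _ x])
        (auto simp: affine_cone_def intro: homogeneous_single)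
  next
    case (Suc l)
    then have "Z l \<subset> Z k" using Suc.prems(2)[of l] by simp
    then obtain p where p: "p \<in> Z k" "p \<notin> Z l" by blast
    have irr': "irreducible_closed W (Z l)" using Suc.prems(1)[of l] \<open>k = Suc l\<close> by simp
    note cl' = irreducible_closedD[OF irr']
    obtain d G x where G: "homogeneous d G" "\<And>q y. q \<in> Z l \<Longrightarrow> y \<in> q \<Longrightarrow> poly_eval G y = 0"
      "x \<in> p" "poly_eval G x \<noteq> 0"
      using zariski_closed_separate[OF cl'(1) subsetD[OF cl(1) p(1)] p(2)] by blast
    have xZ: "x \<in> affine_cone (Z k)" using p(1) G(3) unfolding affine_cone_def by blast
    have G0: "\<forall>x\<in>?C. poly_eval G x = 0"
      using poly_eval_affine_cone[OF G(1) cl'(3,2) G(2)] Suc by simp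
    show ?thesis
      by (intro exI[of _ d] exI[of _ G] exI[of _ x] conjI G(1,4) xZ G0)
  qed
  then obtain e g x0 where g: "homogeneous e g" "x0 \<in> affine_cone (Z k)" "poly_eval g x0 \<noteq> 0"
    and g0: "\<forall>x\<in>?C. poly_eval g x = 0" by (elim exE conjE) (rule that)
  have "?C \<subseteq> affine_cone (Z k)"
  proof (cases k)
    case (Suc l)
    then have "Z l \<subseteq> Z k" using Suc.prems(2)[of l] by auto
    then show ?thesis using Suc affine_cone_mono[of "Z l" "Z k"] by simp
  qed (auto simp: affine_cone_def)
  from alg_indep_Cons[OF fs(2) this affine_cone_scale[OF cl(1)] graded_prime_affine_cone[OF irr] g
      bspec[OF g0]]
  have "alg_indep (g # fs) (affine_cone (Z k))" .
  then show ?case using fs(1) by (intro exI[of _ "g # fs"]) simp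
qed

section \<open>The dimension of a linear subspace of projective space\<close>

definition pairing :: "('n::finite \<Rightarrow> complex) \<Rightarrow> ('n \<Rightarrow> complex) \<Rightarrow> complex" where
  "pairing v x = (\<Sum>i\<in>UNIV. v i * x i)"

lemma pairing_simps [simp]:
  "pairing v (x + y) = pairing v x + pairing v y"
  "pairing v (x - y) = pairing v x - pairing v y"
  "pairing v (cscale c x) = c * pairing v x"
  "pairing v 0 = 0" "pairing 0 x = 0"
  by (simp_all add: pairing_def cscale_def algebra_simps sum.distrib sum_subtractf sum_distrib_left)

lemma sum_fun_apply: "(\<Sum>j\<in>J. f j) i = (\<Sum>j\<in>J. f j i)"
  by (induction J rule: infinite_finite_induct) simp_all

lemma pairing_sum: "pairing v (\<Sum>j\<in>J. x j) = (\<Sum>j\<in>J. pairing v (x j))"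
  unfolding pairing_def sum_fun_apply sum_distrib_left by (rule sum.swap)

definition std_vec :: "'n \<Rightarrow> 'n \<Rightarrow> complex" where
  "std_vec i = (\<lambda>k. if k = i then 1 else 0)"

lemma pairing_std_vec [simp]: "pairing v (std_vec i) = v i" "pairing (std_vec i) x = x i"
  by (simp_all add: pairing_def std_vec_def if_distrib[of "\<lambda>t. _ * t"] if_distrib[of "\<lambda>t. t * _"]
      sum.delta cong: if_cong)

definition linear_form :: "('n::finite \<Rightarrow> complex) \<Rightarrow> 'n cpoly" where
  "linear_form v = (\<Sum>i\<in>UNIV. single (single i 1) (v i))"

lemma poly_eval_linear_form [simp]: "poly_eval (linear_form v) x = pairing v x"
  by (simp add: linear_form_def poly_eval_sum pairing_def)

lemma homogeneous_linear_form: "homogeneous 1 (linear_form v)"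
  unfolding linear_form_def by (intro homogeneous_sum homogeneous_single) simp

definition common_kernel :: "nat \<Rightarrow> (nat \<Rightarrow> 'n::finite \<Rightarrow> complex) \<Rightarrow> ('n \<Rightarrow> complex) set" where
  "common_kernel m v = {x. \<forall>j<m. pairing (v j) x = 0}"

lemma subspace_common_kernel: "cfun.subspace (common_kernel m v)"
  by (auto simp: cfun.subspace_def common_kernel_def)

lemma zariski_closed_common_kernel: "zariski_closed UNIV (proj_space (common_kernel m v))"
proof (rule zariski_closedI)
  show "proj_space (common_kernel m v) \<subseteq> proj_space UNIV" by (auto simp: proj_space_def)
  fix p assume p: "p \<in> proj_space UNIV" "p \<notin> proj_space (common_kernel m v)"
  then obtain x where x: "x \<in> p" using proj_space_nonempty_point by blast
  have "x \<notin> common_kernel m v"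
    using in_proj_spaceD[OF p(1) x] p(2) proj_point_in_proj_space[OF subspace_common_kernel, of x]
    by blast
  then obtain j where j: "j < m" "pairing (v j) x \<noteq> 0" by (auto simp: common_kernel_def)
  have "poly_eval (linear_form (v j)) y = 0" if "q \<in> proj_space (common_kernel m v)" "y \<in> q" for q y
    using in_proj_space_carrier[OF subspace_common_kernel that] j(1) by (simp add: common_kernel_def)
  moreover have "poly_eval (linear_form (v j)) x \<noteq> 0" using j(2) by simp
  ultimately show "\<exists>d G. homogeneous d G \<and> (\<forall>q\<in>proj_space (common_kernel m v). \<forall>x\<in>q. poly_eval G x = 0) \<and>
      (\<exists>x\<in>p. poly_eval G x \<noteq> 0)"
    using homogeneous_linear_form x by blast
qed

text \<open>A witness of the linear independence of the functionals \<open>v 0, \<dots>, v (m - 1)\<close>: vectors dual to them.\<close>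

definition dual_family ::
  "nat \<Rightarrow> (nat \<Rightarrow> 'n::finite \<Rightarrow> complex) \<Rightarrow> (nat \<Rightarrow> 'n \<Rightarrow> complex) \<Rightarrow> bool" where
  "dual_family m v x \<longleftrightarrow> (\<forall>i<m. \<forall>j<m. pairing (v j) (x i) = (if i = j then 1 else 0))"

lemma dual_familyD: "dual_family m v x \<Longrightarrow> i < m \<Longrightarrow> j < m \<Longrightarrow> pairing (v j) (x i) = (if i = j then 1 else 0)"
  by (simp add: dual_family_def)

lemma dual_family_mem_kernel:
  assumes "dual_family m v x" "k < m"
  shows "x k \<in> common_kernel k v" "x k \<notin> common_kernel (Suc k) v" "x k \<noteq> 0"
proof -
  have 1: "pairing (v k) (x k) = 1" using assms by (simp add: dual_family_def)
  then show "x k \<notin> common_kernel (Suc k) v" by (auto simp: common_kernel_def)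
  show "x k \<noteq> 0" using 1 by auto
  show "x k \<in> common_kernel k v" using assms by (auto simp: common_kernel_def dual_family_def)
qed

lemma irreducible_common_kernel:
  assumes "dual_family m v x" "k < m"
  shows "irreducible_closed UNIV (proj_space (common_kernel k v))"
  by (rule irreducible_closed_subspace[OF subspace_common_kernel zariski_closed_common_kernel
        dual_family_mem_kernel(1,3)[OF assms]])

lemma proj_space_common_kernel_strict:
  assumes "dual_family m v x" "k < m"
  shows "proj_space (common_kernel (Suc k) v) \<subset> proj_space (common_kernel k v)"
proof -
  note x = dual_family_mem_kernel[OF assms]
  have "proj_point (x k) \<in> proj_space (common_kernel k v)"
    "proj_point (x k) \<notin> proj_space (common_kernel (Suc k) v)"
    using x proj_point_in_proj_space[OF subspace_common_kernel x(3)] by auto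
  moreover have "common_kernel (Suc k) v \<subseteq> common_kernel k v" by (auto simp: common_kernel_def)
  then have "proj_space (common_kernel (Suc k) v) \<subseteq> proj_space (common_kernel k v)"
    by (auto simp: proj_space_def)
  ultimately show ?thesis by blast
qed

text \<open>The flag of common kernels, from all of \<open>v\<close> down to none of them, is a chain of linear spaces along
  which the forms \<open>v j\<close> are adjoined one by one. So the codimension \<open>m\<close> of the kernel limits the number
  of independent elements on it.\<close>

lemma alg_indep_common_kernel:
  fixes v :: "nat \<Rightarrow> 'n::finite \<Rightarrow> complex"
  assumes "dual_family m v x" "alg_indep fs (common_kernel m v)"
  shows "length fs + m \<le> CARD('n)"
  using assms
proof (induction m arbitrary: fs)
  case 0
  then show ?case using alg_indep_length_le by auto
next
  case (Suc m)
  have dual: "dual_family m v x" using Suc.prems(1) by (simp add: dual_family_def)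
  note x = dual_family_mem_kernel[OF Suc.prems(1) lessI]
  have "alg_indep (linear_form (v m) # fs) (common_kernel m v)"
  proof (rule alg_indep_Cons[OF Suc.prems(2) _ _ _ homogeneous_linear_form x(1)])
    show "graded_prime (common_kernel m v)"
      unfolding graded_prime_def
      using poly_eval_mult_eq_0_subspace[OF subspace_common_kernel] by blast
    show "poly_eval (linear_form (v m)) (x m) \<noteq> 0"
      using dual_familyD[OF Suc.prems(1), of m m] by simp
  qed (auto simp: common_kernel_def)
  from Suc.IH[OF dual this] show ?case by simp
qed

lemma dual_family_length_le:
  fixes v :: "nat \<Rightarrow> 'n::finite \<Rightarrow> complex"
  assumes "dual_family m v x"
  shows "m \<le> CARD('n)"
  using alg_indep_common_kernel[OF assms alg_indep_Nil[of 0]]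
    cfun.subspace_0[OF subspace_common_kernel[of m v]] by simp

lemma dual_family_expand:
  assumes "dual_family m v x" "common_kernel m v = {0}"
  shows "y = (\<Sum>j<m. cscale (pairing (v j) y) (x j))"
proof -
  have "pairing (v k) (y - (\<Sum>j<m. cscale (pairing (v j) y) (x j))) = 0" if k: "k < m" for k
  proof -
    have "(\<Sum>j<m. pairing (v j) y * pairing (v k) (x j)) = (\<Sum>j<m. if j = k then pairing (v j) y else 0)"
      using dual_familyD[OF assms(1) _ k] by (intro sum.cong) auto
    then show ?thesis using k by (simp add: pairing_sum)
  qed
  then have "y - (\<Sum>j<m. cscale (pairing (v j) y) (x j)) \<in> common_kernel m v"
    by (simp add: common_kernel_def)
  with assms(2) show ?thesis by simp
qed

text \<open>If the common kernel is zero, then the identity equals \<open>\<Sum>j<m. x j \<otimes> v j\<close>. Comparing traces gives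
  \<open>CARD('n) = m\<close>.\<close>

lemma dual_family_complete:
  fixes v :: "nat \<Rightarrow> 'n::finite \<Rightarrow> complex"
  assumes "dual_family m v x" "common_kernel m v = {0}"
  shows "m = CARD('n)"
proof -
  have "(1::complex) = (\<Sum>j<m. v j i * x j i)" for i
  proof -
    have "std_vec i i = (\<Sum>j<m. cscale (pairing (v j) (std_vec i)) (x j)) i"
      by (rule fun_cong[OF dual_family_expand[OF assms, of "std_vec i"]])
    also have "\<dots> = (\<Sum>j<m. v j i * x j i)"
      by (simp add: sum_fun_apply cscale_def)
    finally show ?thesis by (simp add: std_vec_def)
  qed
  then have "(\<Sum>i\<in>(UNIV::'n set). (1::complex)) = (\<Sum>i\<in>UNIV. \<Sum>j<m. v j i * x j i)" by simp
  also have "\<dots> = (\<Sum>j<m. pairing (v j) (x j))"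
    by (subst sum.swap) (simp add: pairing_def)
  also have "\<dots> = (\<Sum>j<m. 1)"
    by (rule sum.cong) (use dual_familyD[OF assms(1)] in auto)
  finally have "of_nat CARD('n) = (of_nat m :: complex)" by simp
  then show ?thesis by (simp only: of_nat_eq_iff)
qed

text \<open>A nonzero \<open>z\<close> in the common kernel is a new dual vector for a suitable multiple \<open>u\<close> of a coordinate
  functional; the old dual vectors are corrected by multiples of \<open>z\<close> so that \<open>u\<close> kills them.\<close>

lemma dual_family_extend:
  assumes dual: "dual_family m v x" and z: "z \<in> common_kernel m v" "z \<noteq> 0"
  shows "\<exists>u y. dual_family (Suc m) (v(m := u)) y"
proof -
  obtain i where i: "z i \<noteq> 0" using z(2) by (auto simp: fun_eq_iff)
  define u where "u = cscale (1 / z i) (std_vec i)"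
  have u: "pairing u y = y i / z i" for y
  proof -
    have "pairing u y = 1 / z i * pairing (std_vec i) y"
      unfolding u_def pairing_def by (simp add: cscale_def sum_distrib_left mult.assoc)
    then show ?thesis by simp
  qed
  define y where "y = (\<lambda>j. if j = m then z else x j - cscale (pairing u (x j)) z)"
  have "pairing ((v(m := u)) j) (y k) = (if k = j then 1 else 0)" if "k < Suc m" "j < Suc m" for j k
  proof -
    have zj: "pairing (v j) z = 0" if "j < m" using z(1) that by (simp add: common_kernel_def)
    have "pairing u z = 1" using i by (simp add: u)
    then show ?thesis using zj dual_familyD[OF dual, of k j] that unfolding y_def
      by (auto simp: less_Suc_eq)
  qed
  then show ?thesis unfolding dual_family_def by blast
qed

lemma dual_family_extend_basis:
  fixes v :: "nat \<Rightarrow> 'n::finite \<Rightarrow> complex"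
  assumes "dual_family m v x"
  shows "\<exists>v' x'. dual_family CARD('n) v' x' \<and> (\<forall>j<m. v' j = v j)"
  using assms
proof (induction "CARD('n) - m" arbitrary: m v x rule: less_induct)
  case less
  show ?case
  proof (cases "common_kernel m v = {0}")
    case True
    from dual_family_complete[OF less.prems True] less.prems show ?thesis by blast
  next
    case False
    then obtain z where "z \<in> common_kernel m v" "z \<noteq> 0"
      using cfun.subspace_0[OF subspace_common_kernel] by blast
    from dual_family_extend[OF less.prems this]
    obtain u y where uy: "dual_family (Suc m) (v(m := u)) y" by blast
    have "CARD('n) - Suc m < CARD('n) - m" using dual_family_length_le[OF uy] by simp
    from less.hyps[OF this uy] obtain v' x'
      where "dual_family CARD('n) v' x'" "\<forall>j<Suc m. v' j = (v(m := u)) j" by blast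
    then show ?thesis by (intro exI[of _ v'] exI[of _ x']) auto
  qed
qed

lemma common_kernel_cong: "(\<And>j. j < m \<Longrightarrow> v j = v' j) \<Longrightarrow> common_kernel m v = common_kernel m v'"
  by (auto simp: common_kernel_def)

text \<open>The flag of common kernels below \<open>common_kernel m v\<close> is a chain of \<open>CARD('n) - m\<close> irreducible sets.
  A longer chain would give too many algebraically independent elements on the kernel.\<close>

lemma proj_dim_common_kernel:
  fixes v :: "nat \<Rightarrow> 'n::finite \<Rightarrow> complex"
  assumes "dual_family m v x"
  shows "proj_dim UNIV (proj_space (common_kernel m v)) = int CARD('n) - int m - 1"
proof -
  let ?N = "CARD('n)"
  obtain w y where wy: "dual_family ?N w y" "\<forall>j<m. w j = v j"
    using dual_family_extend_basis[OF assms] by blast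
  have K: "common_kernel m v = common_kernel m w" using wy(2) by (intro common_kernel_cong) simp
  have m: "m \<le> ?N" by (rule dual_family_length_le[OF assms])
  let ?P = "\<lambda>j. proj_space (common_kernel j w)"
  \<comment> \<open>The flag starts at a single point, \<open>?P (?N - 1)\<close>, because \<open>?P ?N\<close> is empty.\<close>
  define Z where "Z i = ?P (?N - 1 - i)" for i
  have irr: "irreducible_closed UNIV (Z j)" if "j < ?N - m" for j
    unfolding Z_def by (rule irreducible_common_kernel[OF wy(1)]) (use that in auto)
  have sub: "Z j \<subseteq> ?P m" if "j < ?N - m" for j
  proof -
    have "common_kernel (?N - 1 - j) w \<subseteq> common_kernel m w" using that by (auto simp: common_kernel_def)
    then show ?thesis by (auto simp: Z_def proj_space_def)
  qed
  have strict: "Z j \<subset> Z (Suc j)" if "Suc j < ?N - m" for j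
  proof -
    have "Suc (?N - 1 - Suc j) = ?N - 1 - j" using that by simp
    then show ?thesis
      using proj_space_common_kernel_strict[OF wy(1), of "?N - 1 - Suc j"] that by (simp add: Z_def)
  qed
  let ?S = "{int k - 1 | k. \<exists>Z :: nat \<Rightarrow> ('n \<Rightarrow> complex) set set.
       (\<forall>j<k. irreducible_closed UNIV (Z j) \<and> Z j \<subseteq> ?P m) \<and> (\<forall>j. Suc j < k \<longrightarrow> Z j \<subset> Z (Suc j))}"
  have "Sup ?S = int (?N - m) - 1"
  proof (rule cSup_eq_maximum)
    show "int (?N - m) - 1 \<in> ?S" using irr sub strict by blast
    fix s assume "s \<in> ?S"
    then obtain k Z where k: "s = int k - 1"
      and Z: "\<And>j. j < k \<Longrightarrow> irreducible_closed UNIV (Z j)" "\<And>j. j < k \<Longrightarrow> Z j \<subseteq> ?P m"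
        "\<And>j. Suc j < k \<Longrightarrow> Z j \<subset> Z (Suc j)" by blast
    obtain fs where fs: "length fs = k" "alg_indep fs (if k = 0 then {0} else affine_cone (Z (k - 1)))"
      using chain_alg_indep[of k UNIV Z, OF Z(1,3)] by blast
    have "(if k = 0 then {0} else affine_cone (Z (k - 1))) \<subseteq> common_kernel m w"
    proof (cases "k = 0")
      case True
      then show ?thesis using cfun.subspace_0[OF subspace_common_kernel[of m w]] by simp
    next
      case False
      then have "affine_cone (Z (k - 1)) \<subseteq> affine_cone (?P m)" using Z(2) by (intro affine_cone_mono) simp
      then show ?thesis using False by (simp add: affine_cone_proj_space[OF subspace_common_kernel])
    qed
    from alg_indep_mono[OF fs(2) this] have "alg_indep fs (common_kernel m v)" unfolding K .
    from alg_indep_common_kernel[OF assms this] show "s \<le> int (?N - m) - 1" using k fs(1) by simp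
  qed
  then show ?thesis unfolding proj_dim_def K using m by simp
qed

lemma proj_codim_common_kernel:
  "dual_family m v x \<Longrightarrow> proj_codim (proj_space (common_kernel m v)) = int m"
  by (simp add: proj_codim_def proj_dim_common_kernel)

section \<open>Quadratic forms as sums of squares\<close>

lemma mon_degree_SucE:
  assumes "mon_degree m = Suc d"
  obtains i m' where "m = single i 1 + m'" "mon_degree m' = d"
proof -
  have "\<exists>i. lookup m i \<noteq> 0"
  proof (rule ccontr)
    assume "\<not> ?thesis"
    then have "mon_degree m = 0" by (simp add: mon_degree_def)
    with assms show False by simp
  qed
  then obtain i where i: "lookup m i \<noteq> 0" by blast
  have m: "m = single i 1 + (m - single i 1)"
    by (rule poly_mapping_eqI) (use i in \<open>auto simp: lookup_add lookup_minus lookup_single when_def\<close>)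
  have "mon_degree m = Suc (mon_degree (m - single i 1))"
    by (subst m) (simp add: mon_degree_add)
  with assms m show thesis by (intro that) auto
qed

lemma mon_degree_2E:
  assumes "mon_degree m = 2"
  obtains i k where "m = single i 1 + single k 1"
proof -
  obtain i m' where m: "m = single i 1 + m'" "mon_degree m' = 1"
    using mon_degree_SucE[of m 1] assms by auto
  obtain k m'' where m': "m' = single k 1 + m''" "mon_degree m'' = 0"
    using mon_degree_SucE[of m' 0] m(2) by auto
  have "m'' = 0"
    by (rule poly_mapping_eqI) (use lookup_le_mon_degree[of m''] m'(2) in auto)
  with m m' that show thesis by simp
qed

lemma single_add_single_eq_iff:
  "single i (1::nat) + single k 1 = single p 1 + single q 1 \<longleftrightarrow> (i = p \<and> k = q) \<or> (i = q \<and> k = p)"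
proof
  assume eq: "single i (1::nat) + single k 1 = single p 1 + single q 1"
  have "lookup (single i (1::nat) + single k 1) j = lookup (single p 1 + single q 1) j" for j by (simp only: eq)
  from this[of i] this[of k] this[of p] this[of q]
  show "(i = p \<and> k = q) \<or> (i = q \<and> k = p)"
    by (auto simp: lookup_add lookup_single when_def split: if_splits)
qed (auto simp: add.commute)

text \<open>The symmetric matrix of a quadratic form. An off-diagonal coefficient of the form is shared by two
  entries, whence the factor \<open>1 / 2\<close>.\<close>

definition gram :: "'n cpoly \<Rightarrow> 'n \<Rightarrow> 'n \<Rightarrow> complex" where
  "gram F i k = (if i = k then 1 else 1 / 2) * lookup F (single i 1 + single k 1)"

lemma gram_commute: "gram F i k = gram F k i"
  by (simp add: gram_def add.commute)

lemma gram_sum: "gram (\<Sum>j\<in>J. F j) i k = (\<Sum>j\<in>J. gram (F j) i k)"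
  by (simp add: gram_def lookup_sum sum_distrib_left)

lemma gram_diff: "gram (F - G) i k = gram F i k - gram G i k"
  by (simp add: gram_def lookup_minus right_diff_distrib)

lemma gram_eq_0:
  assumes "homogeneous 2 F" "\<And>i k. gram F i k = 0"
  shows "F = 0"
proof (rule poly_mapping_eqI)
  fix m
  show "lookup F m = lookup 0 m"
  proof (rule ccontr)
    assume m: "lookup F m \<noteq> lookup 0 m"
    then have "mon_degree m = 2" using homogeneousD[OF assms(1)] by simp
    then obtain i k where "m = single i 1 + single k 1" by (rule mon_degree_2E)
    with assms(2)[of i k] m show False by (simp add: gram_def split: if_splits)
  qed
qed

lemma linear_form_square:
  "linear_form w ^ 2 = (\<Sum>a\<in>UNIV. \<Sum>b\<in>UNIV. single (single a 1 + single b 1) (w a * w b))"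
  by (simp add: linear_form_def power2_eq_square sum_product mult_single)

lemma homogeneous_linear_form_square: "homogeneous 2 (linear_form w ^ 2)"
  using homogeneous_power[OF homogeneous_linear_form, of 2 w] by simp

lemma gram_linear_form_square: "gram (linear_form w ^ 2) i k = w i * w k"
proof -
  have "lookup (linear_form w ^ 2) (single i 1 + single k 1) =
      (\<Sum>a\<in>UNIV. \<Sum>b\<in>UNIV. if (a, b) \<in> {(i, k), (k, i)} then w a * w b else 0)"
    unfolding linear_form_square lookup_sum lookup_single when_def single_add_single_eq_iff
    by (intro sum.cong refl) auto
  also have "\<dots> = (\<Sum>p\<in>UNIV. if p \<in> {(i, k), (k, i)} then w (fst p) * w (snd p) else 0)"
    by (simp add: sum.cartesian_product split_beta prod_eq_iff)
  also have "\<dots> = (\<Sum>p\<in>{(i, k), (k, i)}. w (fst p) * w (snd p))"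
    by (subst sum.inter_restrict[symmetric]) simp_all
  finally show ?thesis by (cases "i = k") (auto simp: gram_def)
qed

definition polar_form :: "'n::finite cpoly \<Rightarrow> ('n \<Rightarrow> complex) \<Rightarrow> ('n \<Rightarrow> complex) \<Rightarrow> complex" where
  "polar_form F x y = pairing (\<lambda>i. pairing (gram F i) x) y"

lemma polar_form_altdef: "polar_form F x y = (\<Sum>i\<in>UNIV. \<Sum>k\<in>UNIV. gram F i k * (x k * y i))"
  by (simp add: polar_form_def pairing_def sum_distrib_right mult.assoc)

lemma polar_form_commute: "polar_form F x y = polar_form F y x"
  unfolding polar_form_altdef by (subst sum.swap) (simp add: gram_commute mult.commute)

lemma polar_form_right [simp]:
  "polar_form F x (y + z) = polar_form F x y + polar_form F x z"
  "polar_form F x (y - z) = polar_form F x y - polar_form F x z"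
  "polar_form F x (cscale c y) = c * polar_form F x y"
  "polar_form F x (\<Sum>j\<in>J. w j) = (\<Sum>j\<in>J. polar_form F x (w j))"
  by (simp_all add: polar_form_def pairing_sum)

lemma polar_form_left [simp]:
  "polar_form F (y + z) x = polar_form F y x + polar_form F z x"
  "polar_form F (y - z) x = polar_form F y x - polar_form F z x"
  "polar_form F (cscale c y) x = c * polar_form F y x"
  "polar_form F (\<Sum>j\<in>J. w j) x = (\<Sum>j\<in>J. polar_form F (w j) x)"
  by (simp_all only: polar_form_commute[of F _ x] polar_form_right)

lemma polar_form_sum: "polar_form (\<Sum>j\<in>J. F j) x y = (\<Sum>j\<in>J. polar_form (F j) x y)"
proof -
  have "polar_form (\<Sum>j\<in>J. F j) x y = (\<Sum>i\<in>UNIV. \<Sum>k\<in>UNIV. \<Sum>j\<in>J. gram (F j) i k * (x k * y i))"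
    by (simp add: polar_form_altdef gram_sum sum_distrib_right)
  also have "\<dots> = (\<Sum>i\<in>UNIV. \<Sum>j\<in>J. \<Sum>k\<in>UNIV. gram (F j) i k * (x k * y i))"
    by (rule sum.cong[OF refl]) (rule sum.swap)
  also have "\<dots> = (\<Sum>j\<in>J. \<Sum>i\<in>UNIV. \<Sum>k\<in>UNIV. gram (F j) i k * (x k * y i))"
    by (rule sum.swap)
  finally show ?thesis by (simp add: polar_form_altdef)
qed

lemma polar_form_diff: "polar_form (F - G) x y = polar_form F x y - polar_form G x y"
  by (simp add: polar_form_altdef gram_diff left_diff_distrib sum_subtractf)

lemma polar_form_std_vec: "polar_form F (std_vec k) (std_vec i) = gram F i k"
  by (simp add: polar_form_def)

lemma polar_form_linear_form_square:
  "polar_form (linear_form w ^ 2) x y = pairing w x * pairing w y"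
  unfolding polar_form_def gram_linear_form_square pairing_def
  by (simp add: sum_distrib_left sum_distrib_right mult.assoc mult.left_commute)

lemma polar_form_isotropic:
  assumes "\<And>z. polar_form F z z = 0"
  shows "polar_form F x y = 0"
proof -
  have "polar_form F (x + y) (x + y) = 0" by (rule assms)
  then have "2 * polar_form F x y = 0"
    using assms[of x] assms[of y] polar_form_commute[of F x y] by simp
  then show ?thesis by simp
qed

definition square_sum :: "nat \<Rightarrow> (nat \<Rightarrow> 'n::finite \<Rightarrow> complex) \<Rightarrow> 'n cpoly" where
  "square_sum m v = (\<Sum>j<m. linear_form (v j) ^ 2)"

lemma elementary_sym_2: "(\<Sum>j<m. elementary_sym 2 (v j)) = square_sum m v"
  by (simp add: square_sum_def elementary_sym_def linear_form_def)

lemma homogeneous_square_sum: "homogeneous 2 (square_sum m v)"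
  unfolding square_sum_def by (intro homogeneous_sum homogeneous_linear_form_square)

lemma polar_form_square_sum: "polar_form (square_sum m v) x y = (\<Sum>j<m. pairing (v j) x * pairing (v j) y)"
  by (simp add: square_sum_def polar_form_sum polar_form_linear_form_square)

lemma square_sum_cong: "(\<And>j. j < m \<Longrightarrow> v j = w j) \<Longrightarrow> square_sum m v = square_sum m w"
  by (simp add: square_sum_def)

text \<open>One step of the Lagrange reduction. If \<open>F\<close> is not yet the sum of the squares found so far, the
  remainder \<open>G\<close> has a vector \<open>z1\<close> with \<open>G(z1, z1) = 1\<close>, and subtracting the square of the functional
  \<open>l = G(z1, -)\<close> puts \<open>z1\<close> into the radical. The radical keeps the earlier \<open>x j\<close>, so \<open>l\<close> vanishes on
  them, and moving \<open>z1\<close> along them into the common kernel of \<open>v\<close> yields the new dual vector \<open>z\<close>.\<close>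

lemma diagonalise_step:
  assumes F: "homogeneous 2 F" and dual: "dual_family m v x"
    and rad: "\<And>j y. j < m \<Longrightarrow> polar_form (F - square_sum m v) (x j) y = 0"
    and ne: "F \<noteq> square_sum m v"
  shows "\<exists>v' x'. dual_family (Suc m) v' x' \<and>
    (\<forall>j<Suc m. \<forall>y. polar_form (F - square_sum (Suc m) v') (x' j) y = 0)"
proof -
  define G where "G = F - square_sum m v"
  have "\<exists>z. polar_form G z z \<noteq> 0"
  proof (rule ccontr)
    assume "\<not> ?thesis"
    then have "polar_form G x y = 0" for x y using polar_form_isotropic by blast
    then have "gram G i k = 0" for i k using polar_form_std_vec[of G k i] by simp
    moreover have "homogeneous 2 G" unfolding G_def
      by (intro homogeneous_diff F homogeneous_square_sum)
    ultimately have "G = 0" by (rule gram_eq_0[rotated])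
    with ne show False by (simp add: G_def)
  qed
  then obtain z0 where z0: "polar_form G z0 z0 \<noteq> 0" by blast
  define c where "c = csqrt (polar_form G z0 z0)"
  have c: "c \<noteq> 0" "c * c = polar_form G z0 z0"
    using z0 by (auto simp: c_def power2_eq_square[symmetric])
  define z1 where "z1 = cscale (1 / c) z0"
  define z where "z = z1 - (\<Sum>j<m. cscale (pairing (v j) z1) (x j))"
  define l where "l = (\<lambda>i. pairing (gram G i) z1)"
  have radG: "polar_form G (x j) y = 0" if "j < m" for j y using rad[OF that] by (simp add: G_def)
  have l: "pairing l y = polar_form G z1 y" for y by (simp add: l_def polar_form_def)
  have lx: "pairing l (x j) = 0" if "j < m" for j
    using radG[OF that, of z1] by (simp add: l polar_form_commute)
  have zG: "polar_form G z y = polar_form G z1 y" for y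
    by (simp add: z_def radG)
  have "polar_form G z1 z1 = 1" using c z0 by (simp add: z1_def field_simps)
  then have lz: "pairing l z = 1" using zG[of z1] by (simp add: l polar_form_commute)
  have vz: "pairing (v k) z = 0" if k: "k < m" for k
  proof -
    have "(\<Sum>j<m. pairing (v j) z1 * pairing (v k) (x j)) = (\<Sum>j<m. if j = k then pairing (v j) z1 else 0)"
      using dual_familyD[OF dual _ k] by (intro sum.cong) auto
    then show ?thesis using k by (simp add: z_def pairing_sum)
  qed
  have "dual_family (Suc m) (v(m := l)) (x(m := z))"
    unfolding dual_family_def using dual_familyD[OF dual] lx lz vz by (auto simp: less_Suc_eq)
  moreover have "polar_form (F - square_sum (Suc m) (v(m := l))) ((x(m := z)) j) y = 0"
    if "j < Suc m" for j y
  proof -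
    have "square_sum (Suc m) (v(m := l)) = square_sum m v + linear_form l ^ 2"
      using square_sum_cong[of m "v(m := l)" v] by (simp add: square_sum_def)
    then have "F - square_sum (Suc m) (v(m := l)) = G - linear_form l ^ 2"
      by (simp add: G_def)
    then show ?thesis using that lx lz radG zG
      by (auto simp: polar_form_diff polar_form_linear_form_square l less_Suc_eq)
  qed
  ultimately show ?thesis by blast
qed

text \<open>The reduction stops because dual families have at most \<open>CARD('n)\<close> members.\<close>

lemma diagonalise:
  fixes F :: "'n::finite cpoly"
  assumes F: "homogeneous 2 F"
  shows "\<exists>m v x. dual_family m v x \<and> F = square_sum m v"
proof -
  have "\<exists>m v x. dual_family m v x \<and> F = square_sum m v"
    if "dual_family m v x" "\<forall>j<m. \<forall>y. polar_form (F - square_sum m v) (x j) y = 0" for m v x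
    using that
  proof (induction "CARD('n) - m" arbitrary: m v x rule: less_induct)
    case less
    show ?case
    proof (cases "F = square_sum m v")
      case True
      with less.prems(1) show ?thesis by blast
    next
      case False
      obtain v' x' where 1: "dual_family (Suc m) v' x'"
        "\<forall>j<Suc m. \<forall>y. polar_form (F - square_sum (Suc m) v') (x' j) y = 0"
        using diagonalise_step[OF F less.prems(1) _ False] less.prems(2) by blast
      have "CARD('n) - Suc m < CARD('n) - m" using dual_family_length_le[OF 1(1)] by simp
      from less.hyps[OF this 1] show ?thesis .
    qed
  qed
  from this[of 0] show ?thesis by (simp add: dual_family_def)
qed

section \<open>Geometric rank and symmetric rank of a quadratic form\<close>

lemma partial_deriv_superset:
  assumes "finite M" "keys F \<subseteq> M"
  shows "partial_deriv i F = (\<Sum>m\<in>M. single (m - single i 1) (of_nat (lookup m i) * lookup F m))"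
  unfolding partial_deriv_def using assms
  by (intro sum.mono_neutral_left) (auto simp: in_keys_iff)

lemma partial_deriv_add: "partial_deriv i (F + G) = partial_deriv i F + partial_deriv i G"
proof -
  have "keys (F + G) \<subseteq> keys F \<union> keys G" by (rule keys_add)
  then show ?thesis
    using partial_deriv_superset[of "keys F \<union> keys G" "F + G" i]
      partial_deriv_superset[of "keys F \<union> keys G" F i] partial_deriv_superset[of "keys F \<union> keys G" G i]
    by (simp add: lookup_add sum.distrib distrib_left single_add)
qed

lemma partial_deriv_sum: "partial_deriv i (\<Sum>j\<in>J. F j) = (\<Sum>j\<in>J. partial_deriv i (F j))"
proof (induction J rule: infinite_finite_induct)
  case (insert j J)
  then show ?case by (simp add: partial_deriv_add)
qed (simp_all add: partial_deriv_def)

lemma partial_deriv_single: "partial_deriv i (single m c) = single (m - single i 1) (of_nat (lookup m i) * c)"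
  using partial_deriv_superset[of "{m}" "single m c" i] by simp

lemma poly_eval_partial_deriv_quadratic_monomial:
  "poly_eval (partial_deriv i (single (single a 1 + single b 1) c)) x =
    (if a = i then c * x b else 0) + (if b = i then c * x a else 0)"
proof -
  have ab: "single a 1 + single b 1 - single b 1 = single a (1::nat)" "single a 1 + single b 1 - single a 1 = single b (1::nat)"
    by (rule poly_mapping_eqI, simp add: lookup_add lookup_minus)+
  show ?thesis
    unfolding partial_deriv_single
    by (cases "a = i"; cases "b = i")
      (use ab in \<open>auto simp: lookup_add lookup_single when_def\<close>)
qed

lemma poly_eval_partial_deriv_square_sum:
  "poly_eval (partial_deriv i (square_sum m v)) x = 2 * (\<Sum>j<m. v j i * pairing (v j) x)"
proof -
  have "poly_eval (partial_deriv i (linear_form w ^ 2)) x = 2 * (w i * pairing w x)" for w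
  proof -
    have "poly_eval (partial_deriv i (linear_form w ^ 2)) x =
        (\<Sum>a\<in>UNIV. \<Sum>b\<in>UNIV. if a = i then w a * w b * x b else 0) +
        (\<Sum>a\<in>UNIV. \<Sum>b\<in>UNIV. if b = i then w a * w b * x a else 0)"
      unfolding linear_form_square partial_deriv_sum poly_eval_sum
        poly_eval_partial_deriv_quadratic_monomial sum.distrib ..
    also have "(\<Sum>a\<in>UNIV. \<Sum>b\<in>UNIV. if a = i then w a * w b * x b else 0) =
        (\<Sum>a\<in>UNIV. if a = i then (\<Sum>b\<in>UNIV. w a * w b * x b) else 0)"
      by (intro sum.cong) auto
    finally show ?thesis
      by (simp add: pairing_def sum_distrib_left mult.assoc mult.left_commute)
  qed
  then show ?thesis
    by (simp add: square_sum_def partial_deriv_sum poly_eval_sum sum_distrib_left)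
qed

text \<open>The gradient of \<open>\<Sum>j<m. (v j)\<^sup>2\<close> at \<open>y\<close> is a combination of the \<open>v j\<close> with coefficients \<open>2 (v j)(y)\<close>.
  By independence it is zero only if all these coefficients are.\<close>

lemma singular_locus_square_sum:
  assumes "dual_family m v x"
  shows "proj_zeros UNIV (range (\<lambda>i. partial_deriv i (square_sum m v))) =
    proj_space (common_kernel m v)"
proof -
  have ker: "(\<forall>i. poly_eval (partial_deriv i (square_sum m v)) y = 0) \<longleftrightarrow> y \<in> common_kernel m v" for y
  proof
    assume y: "\<forall>i. poly_eval (partial_deriv i (square_sum m v)) y = 0"
    have "pairing (v k) y = 0" if k: "k < m" for k
    proof -
      have "(\<Sum>i\<in>UNIV. (\<Sum>j<m. v j i * pairing (v j) y) * x k i) = 0"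
        using y by (simp add: poly_eval_partial_deriv_square_sum)
      also have "(\<Sum>i\<in>UNIV. (\<Sum>j<m. v j i * pairing (v j) y) * x k i)
          = (\<Sum>j<m. pairing (v j) (x k) * pairing (v j) y)"
        unfolding pairing_def[of _ "x k"] sum_distrib_right
        by (subst sum.swap) (simp add: mult_ac)
      also have "\<dots> = (\<Sum>j<m. if j = k then pairing (v j) y else 0)"
        using dual_familyD[OF assms k] by (intro sum.cong) auto
      also have "\<dots> = pairing (v k) y" using k by simp
      finally show ?thesis .
    qed
    then show "y \<in> common_kernel m v" by (simp add: common_kernel_def)
  qed (simp add: poly_eval_partial_deriv_square_sum common_kernel_def)
  show ?thesis
  proof (rule Set.set_eqI)
    fix p
    have "p \<in> proj_zeros UNIV (range (\<lambda>i. partial_deriv i (square_sum m v))) \<longleftrightarrow>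
        p \<in> proj_space UNIV \<and> (\<forall>y\<in>p. y \<in> common_kernel m v)"
      unfolding proj_zeros_def ker[symmetric] by blast
    also have "\<dots> \<longleftrightarrow> p \<in> proj_space (common_kernel m v)"
    proof
      assume p: "p \<in> proj_space UNIV \<and> (\<forall>y\<in>p. y \<in> common_kernel m v)"
      then obtain y where "y \<noteq> 0" "p = proj_point y" by (auto simp: proj_space_def)
      with p show "p \<in> proj_space (common_kernel m v)"
        using proj_point_self[of y] by (auto simp: proj_space_def)
    next
      assume p: "p \<in> proj_space (common_kernel m v)"
      then have "p \<in> proj_space UNIV" by (auto simp: proj_space_def)
      with p show "p \<in> proj_space UNIV \<and> (\<forall>y\<in>p. y \<in> common_kernel m v)"
        using in_proj_space_carrier[OF subspace_common_kernel] by blast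
    qed
    finally show "p \<in> proj_zeros UNIV (range (\<lambda>i. partial_deriv i (square_sum m v))) \<longleftrightarrow>
        p \<in> proj_space (common_kernel m v)" .
  qed
qed

lemma sgr_square_sum: "dual_family m v x \<Longrightarrow> sgr (square_sum m v) = int m"
  by (simp add: sgr_def singular_locus_square_sum proj_codim_common_kernel)

text \<open>Rank at most \<open>r\<close> is detected by the determinants of size \<open>r + 1\<close> taken from the polar form.\<close>

definition gram_det :: "nat \<Rightarrow> (nat \<Rightarrow> 'n::finite \<Rightarrow> complex) \<Rightarrow> 'n cpoly \<Rightarrow> complex" where
  "gram_det r x F = det (mat (Suc r) (Suc r) (\<lambda>(a, b). polar_form F (x a) (x b)))"

text \<open>For a sum of \<open>r\<close> squares, the matrix factors as \<open>B\<^sup>T B\<close> through the matrix of values of \<open>r\<close>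
  functionals. A zero row makes \<open>B\<close> square, so both determinants vanish.\<close>

lemma gram_det_square_sum: "gram_det r x (square_sum r w) = 0"
proof -
  define B where "B = mat (Suc r) (Suc r) (\<lambda>(j, a). if j < r then pairing (w j) (x a) else 0)"
  have B: "B \<in> carrier_mat (Suc r) (Suc r)" by (simp add: B_def)
  have "mat (Suc r) (Suc r) (\<lambda>(a, b). polar_form (square_sum r w) (x a) (x b)) = transpose_mat B * B"
    by (rule eq_matI) (auto simp: B_def scalar_prod_def polar_form_square_sum atLeast0LessThan)
  then have "gram_det r x (square_sum r w) = det (transpose_mat B) * det B"
    unfolding gram_det_def using B by (simp add: det_mult[of _ "Suc r"])
  moreover have "det B = 0"
  proof -
    have "(\<Prod>i = 0..<Suc r. B $$ (i, p i)) = 0" if "p permutes {0..<Suc r}" for p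
    proof -
      have "p r < Suc r" using permutes_in_image[OF that, of r] by simp
      then have "B $$ (r, p r) = 0" by (simp add: B_def)
      then show ?thesis by (intro prod_zero) auto
    qed
    then show ?thesis unfolding det_def'[OF B]
      by (intro sum.neutral ballI) (simp only: mem_Collect_eq mult_zero_right)
  qed
  ultimately show ?thesis by simp
qed

text \<open>On dual vectors the polar form is the identity matrix.\<close>

lemma gram_det_dual_family:
  assumes "dual_family m v x" "r < m"
  shows "gram_det r x (square_sum m v) = 1"
proof -
  have "polar_form (square_sum m v) (x a) (x b) = (if a = b then 1 else 0)" if "a < m" "b < m" for a b
  proof -
    have "polar_form (square_sum m v) (x a) (x b) = (\<Sum>j<m. if j = a then if a = b then 1 else 0 else 0)"
      unfolding polar_form_square_sum
      using dual_familyD[OF assms(1)] that by (intro sum.cong) auto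
    then show ?thesis using that by simp
  qed
  then have "mat (Suc r) (Suc r) (\<lambda>(a, b). polar_form (square_sum m v) (x a) (x b)) = 1\<^sub>m (Suc r)"
    using assms(2) by (intro eq_matI) auto
  then show ?thesis by (simp add: gram_det_def)
qed

text \<open>Independent squares cannot be written with fewer squares, because the determinant on the first
  \<open>r + 1\<close> dual vectors distinguishes the two sides.\<close>

lemma square_sum_minimal:
  assumes "dual_family m v x" "square_sum m v = square_sum r w"
  shows "m \<le> r"
  using gram_det_dual_family[OF assms(1), of r] gram_det_square_sum[of r x w] assms(2)
  by (cases "r < m") auto

lemma square_sum_pad:
  assumes "m \<le> r"
  shows "\<exists>w. square_sum m v = square_sum r w"
proof -
  define w where "w j = (if j < m then v j else 0)" for j
  have [simp]: "linear_form 0 = 0" by (simp add: linear_form_def)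
  have "square_sum r w = square_sum m w"
    unfolding square_sum_def
    by (rule sum.mono_neutral_right) (use assms in \<open>auto simp: w_def\<close>)
  also have "\<dots> = square_sum m v" by (rule square_sum_cong) (simp add: w_def)
  finally show ?thesis by metis
qed

lemma symmetric_rank_square_sum:
  assumes "dual_family m v x"
  shows "symmetric_rank 2 (square_sum m v) = m"
  unfolding symmetric_rank_def elementary_sym_2
  by (rule Least_equality) (use square_sum_minimal[OF assms] in blast)+

lemma sgr_eq_symmetric_rank: "homogeneous 2 F \<Longrightarrow> sgr F = int (symmetric_rank 2 F)"
  using diagonalise[of F] sgr_square_sum symmetric_rank_square_sum by metis

lemma sgr_le_iff_square_sum:
  assumes "homogeneous 2 F"
  shows "sgr F \<le> int r \<longleftrightarrow> (\<exists>w. F = square_sum r w)"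
proof -
  obtain m v x where F: "dual_family m v x" "F = square_sum m v" using diagonalise[OF assms] by blast
  then show ?thesis
    using sgr_square_sum[OF F(1)] square_sum_minimal[OF F(1)] square_sum_pad[of m r v] by auto
qed

section \<open>Secant varieties of the quadratic Veronese variety\<close>

lemma lookup_eq_0_iff: "lookup F = 0 \<longleftrightarrow> F = 0"
  by (metis lookup_zero poly_mapping_eqI zero_fun_apply ext)

lemma lookup_scaled_square: "lookup (linear_form (cscale c v) ^ 2) = cscale (c ^ 2) (lookup (linear_form v ^ 2))"
proof
  fix m
  have "lookup (linear_form (cscale c v) ^ 2) m
      = (\<Sum>a\<in>UNIV. \<Sum>b\<in>UNIV. c ^ 2 * lookup (single (single a 1 + single b 1) (v a * v b)) m)"
    unfolding linear_form_square lookup_sum lookup_single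
    by (intro sum.cong refl) (simp add: cscale_def when_def power2_eq_square)
  then show "lookup (linear_form (cscale c v) ^ 2) m = cscale (c ^ 2) (lookup (linear_form v ^ 2)) m"
    by (simp add: linear_form_square lookup_sum cscale_def sum_distrib_left)
qed

lemma lookup_square_sum: "lookup (square_sum r w) = (\<Sum>j<r. lookup (linear_form (w j) ^ 2))"
  by (rule ext) (simp add: square_sum_def lookup_sum sum_fun_apply)

lemma veronese_map_2: "veronese_map 2 (proj_point v) = proj_point (lookup (linear_form v ^ 2))"
proof -
  have "form_point (elementary_sym 2 w) = proj_point (lookup (linear_form v ^ 2))"
    if "w \<in> proj_point v" for w
  proof -
    obtain c where "c \<noteq> 0" "w = cscale c v" using \<open>w \<in> proj_point v\<close> by (auto simp: proj_point_def)
    then have "lookup (linear_form w ^ 2) \<in> proj_point (lookup (linear_form v ^ 2))"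
      by (auto simp: proj_point_def lookup_scaled_square intro!: exI[of _ "c ^ 2"])
    moreover have "elementary_sym 2 w = linear_form w ^ 2"
      unfolding elementary_sym_def linear_form_def ..
    ultimately show ?thesis by (simp only: form_point_def proj_point_eq)
  qed
  then show ?thesis
    unfolding veronese_map_def using proj_point_self[of v] by (intro SUP_eq_const) blast+
qed

text \<open>Each \<open>p j\<close> is a punctured line, so only the choice of one representative \<open>u j\<close> matters for the span.\<close>

lemma span_scaled_union:
  assumes "\<And>j. j < r \<Longrightarrow> p j = proj_point (u j)"
  shows "cfun.span (\<Union>(p ` {..<r})) = {\<Sum>j<(r::nat). cscale (c j) (u j) | c. True}"
proof
  let ?T = "{\<Sum>j<r. cscale (c j) (u j) | c. True}"
  have "cfun.subspace ?T"
    unfolding cfun.subspace_def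
  proof (intro conjI ballI allI)
    show "0 \<in> ?T" by (intro CollectI exI[of _ "\<lambda>_. 0"]) simp
    fix s t assume "s \<in> ?T" "t \<in> ?T"
    then obtain c d where "s = (\<Sum>j<r. cscale (c j) (u j))" "t = (\<Sum>j<r. cscale (d j) (u j))" by blast
    then show "s + t \<in> ?T"
      by (intro CollectI exI[of _ "\<lambda>j. c j + d j"]) (simp add: cfun.scale_left_distrib sum.distrib)
  next
    fix a s assume "s \<in> ?T"
    then obtain c where "s = (\<Sum>j<r. cscale (c j) (u j))" by blast
    then show "cscale a s \<in> ?T"
      by (intro CollectI exI[of _ "\<lambda>j. a * c j"]) (simp add: cfun.scale_sum_right)
  qed
  moreover have "\<Union>(p ` {..<r}) \<subseteq> ?T"
  proof
    fix y assume "y \<in> \<Union>(p ` {..<r})"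
    then obtain k where k: "k < r" "y \<in> p k" by blast
    then obtain c where "y = cscale c (u k)" using assms by (auto simp: proj_point_def)
    moreover have "(\<Sum>j<r. cscale (if j = k then c else 0) (u j)) = (\<Sum>j<r. if j = k then cscale c (u j) else 0)"
      by (intro sum.cong) auto
    ultimately have "y = (\<Sum>j<r. cscale (if j = k then c else 0) (u j))"
      using k by simp
    then show "y \<in> ?T"
      by (intro CollectI exI[of _ "\<lambda>j. if j = k then c else 0"] conjI TrueI)
  qed
  ultimately show "cfun.span (\<Union>(p ` {..<r})) \<subseteq> ?T" by (intro cfun.span_minimal)
  have "(\<Sum>j<r. cscale (c j) (u j)) \<in> cfun.span (\<Union>(p ` {..<r}))" for c
  proof (intro cfun.span_sum cfun.span_scale cfun.span_base)
    fix j assume "j \<in> {..<r}"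
    then show "u j \<in> \<Union>(p ` {..<r})" using assms[of j] proj_point_self[of "u j"] by auto
  qed
  then show "?T \<subseteq> cfun.span (\<Union>(p ` {..<r}))" by blast
qed

definition square_sum_locus :: "nat \<Rightarrow> (('n::finite \<Rightarrow>\<^sub>0 nat) \<Rightarrow> complex) set set" where
  "square_sum_locus r = {form_point (square_sum r w) | w. square_sum r w \<noteq> 0}"

lemma sgr_locus_2:
  "sgr_locus 2 r = (square_sum_locus r :: (('n::finite \<Rightarrow>\<^sub>0 nat) \<Rightarrow> complex) set set)"
proof -
  have "(\<exists>F :: 'n cpoly. p = form_point F \<and> homogeneous 2 F \<and> F \<noteq> 0 \<and> sgr F \<le> int r) \<longleftrightarrow>
      (\<exists>w :: nat \<Rightarrow> 'n \<Rightarrow> complex. p = form_point (square_sum r w) \<and> square_sum r w \<noteq> 0)" for p :: "(('n \<Rightarrow>\<^sub>0 nat) \<Rightarrow> complex) set"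
    using sgr_le_iff_square_sum homogeneous_square_sum by metis
  then show ?thesis by (simp add: sgr_locus_def square_sum_locus_def)
qed

text \<open>Complex coefficients of squares have square roots and can be absorbed into the linear forms.
  Conversely, a zero form among the \<open>w j\<close> gives no point of the Veronese variety; an arbitrary point
  with coefficient \<open>0\<close> takes its place.\<close>

lemma union_spans_veronese:
  "(\<Union>p\<in>{p. \<forall>j<r. p j \<in> veronese_variety 2}. proj_span (sym_space 2) (p ` {..<r})) =
    (square_sum_locus r :: (('n::finite \<Rightarrow>\<^sub>0 nat) \<Rightarrow> complex) set set)"
proof
  let ?X = "veronese_variety 2 :: (('n \<Rightarrow>\<^sub>0 nat) \<Rightarrow> complex) set set"
  show "(\<Union>p\<in>{p. \<forall>j<r. p j \<in> ?X}. proj_span (sym_space 2) (p ` {..<r})) \<subseteq> square_sum_locus r"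
  proof
    fix q assume "q \<in> (\<Union>p\<in>{p. \<forall>j<r. p j \<in> ?X}. proj_span (sym_space 2) (p ` {..<r}))"
    then obtain p where p: "\<forall>j<r. p j \<in> ?X" and q: "q \<in> proj_span (sym_space 2) (p ` {..<r})" by blast
    have "\<forall>j\<in>{..<r}. \<exists>v. p j = proj_point (lookup (linear_form v ^ 2))"
      using p by (force simp: veronese_variety_def proj_space_def veronese_map_2)
    then obtain v where v: "\<And>j. j < r \<Longrightarrow> p j = proj_point (lookup (linear_form (v j) ^ 2))"
      unfolding bchoice_iff by blast
    obtain y where y: "y \<noteq> 0" "q = proj_point y" "y \<in> cfun.span (\<Union>(p ` {..<r}))"
      using q by (auto simp: proj_span_def proj_space_def)
    have "cfun.span (\<Union>(p ` {..<r})) =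
        {\<Sum>j<r. cscale (c j) (lookup (linear_form (v j) ^ 2)) | c. True}"
      by (rule span_scaled_union) (rule v)
    with y(3) obtain c where "y = (\<Sum>j<r. cscale (c j) (lookup (linear_form (v j) ^ 2)))"
      by auto
    then have "y = lookup (square_sum r (\<lambda>j. cscale (csqrt (c j)) (v j)))"
      by (simp add: lookup_square_sum lookup_scaled_square)
    moreover from this y(1) have "square_sum r (\<lambda>j. cscale (csqrt (c j)) (v j)) \<noteq> 0"
      by (metis lookup_eq_0_iff)
    ultimately show "q \<in> square_sum_locus r"
      unfolding square_sum_locus_def form_point_def y(2) by blast
  qed
  show "square_sum_locus r \<subseteq> (\<Union>p\<in>{p. \<forall>j<r. p j \<in> ?X}. proj_span (sym_space 2) (p ` {..<r}))"
  proof
    fix q :: "(('n \<Rightarrow>\<^sub>0 nat) \<Rightarrow> complex) set" assume "q \<in> square_sum_locus r"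
    then obtain w :: "nat \<Rightarrow> 'n \<Rightarrow> complex" where w: "q = proj_point (lookup (square_sum r w))" "square_sum r w \<noteq> 0"
      by (auto simp: square_sum_locus_def form_point_def)
    define v where "v j = (if w j = 0 then std_vec undefined else w j)" for j
    define p where "p j = proj_point (lookup (linear_form (v j) ^ 2))" for j
    have "std_vec undefined \<noteq> (0 :: 'n \<Rightarrow> complex)" by (auto simp: std_vec_def fun_eq_iff)
    then have "v j \<noteq> 0" for j by (simp add: v_def)
    then have "p j \<in> ?X" for j
      unfolding veronese_variety_def proj_space_def p_def veronese_map_2[symmetric] by blast
    moreover have "lookup (square_sum r w) \<in> cfun.span (\<Union>(p ` {..<r}))"
    proof -
      have "lookup (square_sum r w)
          = (\<Sum>j<r. cscale (if w j = 0 then 0 else 1) (lookup (linear_form (v j) ^ 2)))"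
        unfolding lookup_square_sum
      proof (rule sum.cong[OF refl])
        fix j
        have "lookup (linear_form (0 :: 'n \<Rightarrow> complex) ^ 2) = 0"
          by (simp add: lookup_eq_0_iff linear_form_def)
        then show "lookup (linear_form (w j) ^ 2) = cscale (if w j = 0 then 0 else 1) (lookup (linear_form (v j) ^ 2))"
          by (simp add: v_def)
      qed
      then show ?thesis unfolding span_scaled_union[of r p, OF p_def]
        by (intro CollectI exI[of _ "\<lambda>j. if w j = 0 then 0 else 1"] conjI TrueI)
    qed
    moreover have "lookup (square_sum r w) \<in> sym_space 2"
      unfolding sym_space_def using homogeneous_square_sum by blast
    moreover have "lookup (square_sum r w) \<noteq> 0" using w(2) by (simp add: lookup_eq_0_iff)
    ultimately have "q \<in> proj_span (sym_space 2) (p ` {..<r})" "\<forall>j<r. p j \<in> ?X"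
      unfolding proj_span_def proj_space_def w(1) by blast+
    then show "q \<in> (\<Union>p\<in>{p. \<forall>j<r. p j \<in> ?X}. proj_span (sym_space 2) (p ` {..<r}))" by blast
  qed
qed

text \<open>The entries of the polar form are linear in the coefficients of the quadratic form, so the determinant
  is a form of degree \<open>r + 1\<close> on the space of quadratic forms.\<close>

lemma gram_det_polynomial:
  fixes x :: "nat \<Rightarrow> 'n::finite \<Rightarrow> complex"
  shows "\<exists>G :: ('n \<Rightarrow>\<^sub>0 nat) cpoly. homogeneous (Suc r) G \<and> (\<forall>F. poly_eval G (lookup F) = gram_det r x F)"
proof -
  define P :: "nat \<Rightarrow> nat \<Rightarrow> ('n \<Rightarrow>\<^sub>0 nat) cpoly" where "P a b = (\<Sum>i\<in>UNIV. \<Sum>k\<in>UNIV.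
    single (single (single i 1 + single k 1) 1) ((if i = k then 1 else 1 / 2) * (x a k * x b i)))" for a b
  have hom: "homogeneous 1 (P a b)" for a b
    unfolding P_def by (intro homogeneous_sum homogeneous_single) simp
  have eval: "poly_eval (P a b) (lookup F) = polar_form F (x a) (x b)" for a b F
    unfolding P_def polar_form_altdef poly_eval_sum gram_def
    by (intro sum.cong refl) simp
  let ?A = "mat (Suc r) (Suc r) (\<lambda>(a, b). P a b)"
  have "homogeneous (Suc r) (det ?A)"
  proof -
    have "homogeneous (Suc r) (signof p * (\<Prod>i = 0..<Suc r. ?A $$ (i, p i)))"
      if p: "p permutes {0..<Suc r}" for p
    proof -
      have "?A $$ (i, p i) = P i (p i)" if "i < Suc r" for i
        using permutes_in_image[OF p, of i] that by simp
      then have "(\<Prod>i = 0..<Suc r. ?A $$ (i, p i)) = (\<Prod>i = 0..<Suc r. P i (p i))"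
        by (intro prod.cong) auto
      moreover have "homogeneous (Suc r) (\<Prod>i = 0..<Suc r. P i (p i))"
        using homogeneous_prod[of "{0..<Suc r}" 1 "\<lambda>i. P i (p i)"] hom by simp
      ultimately show ?thesis by (cases p rule: sign_cases) (auto intro: homogeneous_uminus)
    qed
    then show ?thesis by (subst det_def'[of _ "Suc r"]) (auto intro!: homogeneous_sum)
  qed
  moreover have "poly_eval (det ?A) (lookup F) = gram_det r x F" for F
  proof -
    have "map_mat (\<lambda>G. poly_eval G (lookup F)) ?A = mat (Suc r) (Suc r) (\<lambda>(a, b). polar_form F (x a) (x b))"
      by (rule eq_matI) (auto simp: eval)
    then show ?thesis unfolding gram_det_def poly_eval.hom_det[symmetric] by simp
  qed
  ultimately show ?thesis by blast
qed

text \<open>A quadratic form that is no sum of \<open>r\<close> squares has more than \<open>r\<close> independent squares; the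
  determinant on their dual vectors is an equation of the locus that fails at this form.\<close>

lemma zariski_closed_square_sum_locus:
  "zariski_closed (sym_space 2) (square_sum_locus r :: (('n::finite \<Rightarrow>\<^sub>0 nat) \<Rightarrow> complex) set set)"
proof (rule zariski_closedI)
  let ?S = "square_sum_locus r :: (('n \<Rightarrow>\<^sub>0 nat) \<Rightarrow> complex) set set"
  show "?S \<subseteq> proj_space (sym_space 2)"
    unfolding square_sum_locus_def form_point_def proj_space_def sym_space_def
    using homogeneous_square_sum by (auto simp: lookup_eq_0_iff intro!: imageI)
  fix p assume p: "p \<in> proj_space (sym_space 2)" "p \<notin> ?S"
  then obtain f where f: "f \<in> sym_space 2" "f \<noteq> 0" "p = proj_point f"
    by (auto simp: proj_space_def)
  then obtain F :: "'n cpoly" where "homogeneous 2 F" "f = lookup F"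
    by (auto simp: sym_space_def)
  with f have F: "homogeneous 2 F" "F \<noteq> 0" "p = form_point F"
    by (auto simp: form_point_def fun_eq_iff)
  obtain m v x where d: "dual_family m v x" "F = square_sum m v" using diagonalise[OF F(1)] by blast
  have "r < m"
  proof (rule ccontr)
    assume "\<not> r < m"
    then obtain w where "F = square_sum r w" using square_sum_pad[of m r v] d(2) by auto
    with F(2,3) p(2) show False by (auto simp: square_sum_locus_def)
  qed
  obtain G :: "('n \<Rightarrow>\<^sub>0 nat) cpoly" where G: "homogeneous (Suc r) G" "\<And>F. poly_eval G (lookup F) = gram_det r x F"
    using gram_det_polynomial by blast
  have "poly_eval G (lookup F) \<noteq> 0"
    using gram_det_dual_family[OF d(1) \<open>r < m\<close>] by (simp add: G(2) d(2))
  moreover have "lookup F \<in> p" by (simp add: F(3) form_point_def)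
  moreover have "poly_eval G y = 0" if "q \<in> ?S" "y \<in> q" for q y
  proof -
    obtain w where w: "q = proj_point (lookup (square_sum r w))"
      using \<open>q \<in> ?S\<close> by (auto simp: square_sum_locus_def form_point_def)
    show ?thesis
      using poly_eval_proj_point[OF G(1), of "lookup (square_sum r w)" y] that(2)
      by (simp add: w G(2) gram_det_square_sum)
  qed
  ultimately show "\<exists>d G. homogeneous d G \<and> (\<forall>q\<in>?S. \<forall>x\<in>q. poly_eval G x = 0) \<and> (\<exists>x\<in>p. poly_eval G x \<noteq> 0)"
    using G(1) by blast
qed

theorem proposition4p1:
  fixes n :: nat
  assumes "n \<ge> 1"
    and "CARD('n::finite) = n + 1"
  shows "(\<forall>F :: 'n cpoly. homogeneous 2 F \<and> F \<noteq> 0 \<longrightarrow> sgr F = int (symmetric_rank 2 F)) \<and>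
    (\<forall>r\<ge>1. (sgr_locus 2 r :: (('n \<Rightarrow>\<^sub>0 nat) \<Rightarrow> complex) set set) =
       secant_variety (sym_space 2) r (veronese_variety 2))"
proof (intro conjI allI impI)
  fix F :: "'n cpoly"
  assume "homogeneous 2 F \<and> F \<noteq> 0"
  then show "sgr F = int (symmetric_rank 2 F)" using sgr_eq_symmetric_rank by blast
next
  fix r :: nat
  have "zariski_closure (sym_space 2) (square_sum_locus r) =
      (square_sum_locus r :: (('n \<Rightarrow>\<^sub>0 nat) \<Rightarrow> complex) set set)"
    unfolding zariski_closure_def
    by (rule hull_same[where S = "zariski_closed (sym_space 2)"]) (rule zariski_closed_square_sum_locus)
  then show "(sgr_locus 2 r :: (('n \<Rightarrow>\<^sub>0 nat) \<Rightarrow> complex) set set) =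
      secant_variety (sym_space 2) r (veronese_variety 2)"
    unfolding secant_variety_def union_spans_veronese sgr_locus_2 by simp
qed

end
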